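(* Let $\mathscr{A}=\{a_1,\ldots,a_n\}\subset\mathbb{Z}$ be a finite set with $0<a_1<\cdots<a_n$ and $\gcd(a_1,\ldots,a_n)=1$, and let $Y_{\mathscr{A}}\subset\mathbb{C}^n$ be the affine toric curve defined by $\mathscr{A}$. Then a finite iteration of Nash modification resolves the singularities of $Y_{\mathscr{A}}$: there exists $k\in\mathbb{N}$ such that the variety obtained from $Y_{\mathscr{A}}$ by applying the Nash modification $k$ times in succession is non-singular.
   Context: $\mathbb{N}=\{0,1,2,\ldots\}$. Toric curve: for $\mathscr{A}=\{a_1,\ldots,a_n\}\subset\mathbb{Z}$ with $0<a_1<\cdots<a_n$ and $\gcd(a_1,\ldots,a_n)=1$, let $\pi_{\mathscr{A}}:\mathbb{N}^n\to\mathbb{Z}$, $\pi_{\mathscr{A}}(\alpha)=\alpha_1a_1+\cdots+\alpha_na_n$, and $I_{\mathscr{A}}=\langle x^{\alpha}-x^{\beta}\mid \alpha,\beta\in\mathbb{N}^n,\ \pi_{\mathscr{A}}(\alpha)=\pi_{\mathscr{A}}(\beta)\rangle\subset\mathbb{C}[x_1,\ldots,x_n]$. The toric curve defined by $\mathscr{A}$ is $Y_{\mathscr{A}}=\mathbf{V}(I_{\mathscr{A}})\subset\mathbb{C}^n$. Throughout, "toric curve" means a curve of this form. Nash modification: let $X\subset\mathbb{C}^n$ be an equidimensional algebraic variety of dimension $d$, and let $G:X\setminus\mathrm{Sing}(X)\to G(d,n)$, $x\mapsto T_xX$, be the Gauss map, where $G(d,n)$ is the Grassmannian of $d$-dimensional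 linear subspaces of $\mathbb{C}^n$ and $T_xX$ is the tangent space to $X$ at $x$. Let $X^*$ be the Zariski closure of the graph of $G$ in $X\times G(d,n)$ and $\nu:X^*\to X$ the restriction of the projection. The pair $(X^*,\nu)$ is the Nash modification of $X$. Known facts (from the literature): the Nash modification of $Y_{\mathscr{A}}$ is isomorphic to the toric curve $Y_{\mathscr{A}'}$, where $\mathscr{A}'=\{a_1\}\cup\{a_2-a_1,\ldots,a_n-a_1\}$ (again a set of positive integers with gcd $1$, after ordering its elements), so iterating Nash modification amounts to iterating $\mathscr{A}\mapsto\mathscr{A}'$; and $Y_{\mathscr{A}}$ is non-singular if and only if $1\in\mathscr{A}$. *)

theory Defs
  imports
    Complex_Main
    "HOL-Library.Poly_Mapping"
    "HOL-Library.Function_Algebras"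
    "HOL-Library.Extended_Nat"
begin

section \<open>Polynomials and algebraic sets\<close>

text \<open>
  Variables are indexed by a finite set \<open>I\<close>; the affine space \<open>\<complex>\<^sup>I\<close> consists of the functions
  that vanish outside \<open>I\<close>.  In particular \<open>\<complex>\<^sup>n\<close> is the space for \<open>I = {..<n}\<close>, with coordinates
  \<open>x 0, \<dots>, x (n - 1)\<close>.
\<close>

type_synonym 'v mpoly = "('v \<Rightarrow>\<^sub>0 nat) \<Rightarrow>\<^sub>0 complex"

definition coord_space :: "'v set \<Rightarrow> ('v \<Rightarrow> complex) set" where
  "coord_space I = {x. \<forall>i. i \<notin> I \<longrightarrow> x i = 0}"

definition poly_ring :: "'v set \<Rightarrow> 'v mpoly set" where
  "poly_ring I = {p. \<forall>\<alpha>\<in>Poly_Mapping.keys p. Poly_Mapping.keys \<alpha> \<subseteq> I}"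

definition poly_eval :: "'v mpoly \<Rightarrow> ('v \<Rightarrow> complex) \<Rightarrow> complex" where
  "poly_eval p x = (\<Sum>\<alpha>\<in>Poly_Mapping.keys p. Poly_Mapping.lookup p \<alpha> *
     (\<Prod>i\<in>Poly_Mapping.keys \<alpha>. x i ^ Poly_Mapping.lookup \<alpha> i))"

definition partial_deriv :: "'v \<Rightarrow> 'v mpoly \<Rightarrow> 'v mpoly" where
  "partial_deriv i p = (\<Sum>\<alpha>\<in>Poly_Mapping.keys p.
     Poly_Mapping.single (\<alpha> - Poly_Mapping.single i 1)
       (of_nat (Poly_Mapping.lookup \<alpha> i) * Poly_Mapping.lookup p \<alpha>))"

definition zero_locus :: "'v set \<Rightarrow> 'v mpoly set \<Rightarrow> ('v \<Rightarrow> complex) set" where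
  "zero_locus I S = {x \<in> coord_space I. \<forall>p\<in>S. poly_eval p x = 0}"

definition vanishing_ideal :: "'v set \<Rightarrow> ('v \<Rightarrow> complex) set \<Rightarrow> 'v mpoly set" where
  "vanishing_ideal I X = {p \<in> poly_ring I. \<forall>x\<in>X. poly_eval p x = 0}"

definition algebraic_set :: "'v set \<Rightarrow> ('v \<Rightarrow> complex) set \<Rightarrow> bool" where
  "algebraic_set I X \<longleftrightarrow> (\<exists>S \<subseteq> poly_ring I. X = zero_locus I S)"

definition ideal_generated :: "'v set \<Rightarrow> 'v mpoly set \<Rightarrow> 'v mpoly set" where
  "ideal_generated I S =
     {\<Sum>s\<in>F. c s * s | F c. finite F \<and> F \<subseteq> S \<and> (\<forall>s\<in>F. c s \<in> poly_ring I)}"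


section \<open>Dimension\<close>

definition irreducible_set :: "'v set \<Rightarrow> ('v \<Rightarrow> complex) set \<Rightarrow> bool" where
  "irreducible_set I Z \<longleftrightarrow> algebraic_set I Z \<and> Z \<noteq> {} \<and>
     (\<forall>Z1 Z2. algebraic_set I Z1 \<and> algebraic_set I Z2 \<and> Z = Z1 \<union> Z2 \<longrightarrow> Z = Z1 \<or> Z = Z2)"

definition irreducible_component ::
  "'v set \<Rightarrow> ('v \<Rightarrow> complex) set \<Rightarrow> ('v \<Rightarrow> complex) set \<Rightarrow> bool" where
  "irreducible_component I X Z \<longleftrightarrow> irreducible_set I Z \<and> Z \<subseteq> X \<and>
     (\<forall>Z'. irreducible_set I Z' \<and> Z \<subseteq> Z' \<and> Z' \<subseteq> X \<longrightarrow> Z' = Z)"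

definition krull_dim :: "'v set \<Rightarrow> ('v \<Rightarrow> complex) set \<Rightarrow> enat" where
  "krull_dim I X = Sup {enat k | k. \<exists>C. (\<forall>i\<le>k. irreducible_set I (C i) \<and> C i \<subseteq> X) \<and>
     (\<forall>i<k. C i \<subset> C (Suc i))}"

definition equidimensional :: "'v set \<Rightarrow> nat \<Rightarrow> ('v \<Rightarrow> complex) set \<Rightarrow> bool" where
  "equidimensional I d X \<longleftrightarrow> algebraic_set I X \<and> X \<noteq> {} \<and>
     (\<forall>Z. irreducible_component I X Z \<longrightarrow> krull_dim I Z = enat d)"


section \<open>Varieties as spaces with functions\<close>

record 'a space_with_functions =
  points :: "'a set"
  opens :: "'a set set"
  regular :: "'a set \<Rightarrow> ('a \<Rightarrow> complex) set" \<comment> \<open>only the values on the given open set matter\<close>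

definition morphism ::
  "'a space_with_functions \<Rightarrow> 'b space_with_functions \<Rightarrow> ('a \<Rightarrow> 'b) \<Rightarrow> bool" where
  "morphism X Y \<phi> \<longleftrightarrow> \<phi> ` points X \<subseteq> points Y \<and>
     (\<forall>V\<in>opens Y. \<phi> -` V \<inter> points X \<in> opens X \<and>
       (\<forall>f\<in>regular Y V. f \<circ> \<phi> \<in> regular X (\<phi> -` V \<inter> points X)))"

definition isomorphism ::
  "'a space_with_functions \<Rightarrow> 'b space_with_functions \<Rightarrow> ('a \<Rightarrow> 'b) \<Rightarrow> bool" where
  "isomorphism X Y \<phi> \<longleftrightarrow> morphism X Y \<phi> \<and>
     (\<exists>\<psi>. morphism Y X \<psi> \<and> (\<forall>x\<in>points X. \<psi> (\<phi> x) = x) \<and> (\<forall>y\<in>points Y. \<phi> (\<psi> y) = y))"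

definition zariski_opens :: "'v set \<Rightarrow> ('v \<Rightarrow> complex) set \<Rightarrow> ('v \<Rightarrow> complex) set set" where
  "zariski_opens I X = {X - zero_locus I S | S. S \<subseteq> poly_ring I}"

definition subspace_of_affine ::
  "'v set \<Rightarrow> ('v \<Rightarrow> complex) set \<Rightarrow> ('v \<Rightarrow> complex) space_with_functions" where
  "subspace_of_affine I X = \<lparr>
     points = X,
     opens = zariski_opens I X,
     regular = (\<lambda>U. {f. \<forall>x\<in>U. \<exists>V\<in>zariski_opens I U. \<exists>g\<in>poly_ring I. \<exists>h\<in>poly_ring I.
       x \<in> V \<and> (\<forall>y\<in>V. poly_eval h y \<noteq> 0 \<and> f y = poly_eval g y / poly_eval h y)})\<rparr>"


section \<open>Tangent spaces and singular points\<close>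

global_interpretation cvec: vector_space "\<lambda>(c::complex) (v::nat \<Rightarrow> complex) i. c * v i"
  by unfold_locales (auto simp: fun_eq_iff algebra_simps)

definition tangent_space ::
  "nat \<Rightarrow> (nat \<Rightarrow> complex) set \<Rightarrow> (nat \<Rightarrow> complex) \<Rightarrow> (nat \<Rightarrow> complex) set" where
  "tangent_space n X x = {v \<in> coord_space {..<n}. \<forall>f\<in>vanishing_ideal {..<n} X.
     (\<Sum>i<n. poly_eval (partial_deriv i f) x * v i) = 0}"

text \<open>For \<open>X\<close> equidimensional of dimension \<open>d\<close>.\<close>

definition singular_locus :: "nat \<Rightarrow> nat \<Rightarrow> (nat \<Rightarrow> complex) set \<Rightarrow> (nat \<Rightarrow> complex) set" where
  "singular_locus n d X = {x \<in> X. cvec.dim (tangent_space n X x) \<noteq> d}"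

definition nonsingular :: "nat \<Rightarrow> (nat \<Rightarrow> complex) set \<Rightarrow> bool" where
  "nonsingular n X \<longleftrightarrow> (\<exists>d. equidimensional {..<n} d X \<and> singular_locus n d X = {})"


section \<open>Grassmannians\<close>

definition grassmannian :: "nat \<Rightarrow> nat \<Rightarrow> (nat \<Rightarrow> complex) set set" where
  "grassmannian d n = {W. cvec.subspace W \<and> W \<subseteq> coord_space {..<n} \<and> cvec.dim W = d}"

text \<open>
  The variety structure on \<open>\<complex>\<^sup>n \<times> G(d, n)\<close> is that of the quotient of \<open>\<complex>\<^sup>n \<times> {d-frames in \<complex>\<^sup>n}\<close>
  by the base changes of frames; for \<open>d = 1\<close> the second factor is the projective space
  \<open>(\<complex>\<^sup>n - {0}) / \<complex>\<^sup>*\<close>.  A pair of a point and a frame is a vector with the coordinates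
  of the point at \<open>Inl i\<close> and the \<open>i\<close>-th coordinate of the \<open>j\<close>-th frame vector at \<open>Inr (j, i)\<close>.
  As the quotient map has local sections, a set is open iff its preimage is, and a function is
  regular iff its pullback is.
\<close>

type_synonym framed_point = "nat + nat \<times> nat \<Rightarrow> complex"

definition frame_index :: "nat \<Rightarrow> nat \<Rightarrow> (nat + nat \<times> nat) set" where
  "frame_index d n = {..<n} <+> ({..<d} \<times> {..<n})"

definition frame_span :: "nat \<Rightarrow> framed_point \<Rightarrow> (nat \<Rightarrow> complex) set" where
  "frame_span d y = cvec.span ((\<lambda>j i. y (Inr (j, i))) ` {..<d})"

definition frame_quotient ::
  "nat \<Rightarrow> framed_point \<Rightarrow> (nat \<Rightarrow> complex) \<times> (nat \<Rightarrow> complex) set" where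
  "frame_quotient d y = (y \<circ> Inl, frame_span d y)"

definition frame_preimage ::
  "nat \<Rightarrow> nat \<Rightarrow> ((nat \<Rightarrow> complex) \<times> (nat \<Rightarrow> complex) set) set \<Rightarrow> framed_point set" where
  "frame_preimage d n Z = {y \<in> coord_space (frame_index d n).
     cvec.dim (frame_span d y) = d \<and> frame_quotient d y \<in> Z}"

definition subspace_of_grassmann_bundle ::
  "nat \<Rightarrow> nat \<Rightarrow> ((nat \<Rightarrow> complex) \<times> (nat \<Rightarrow> complex) set) set \<Rightarrow>
   ((nat \<Rightarrow> complex) \<times> (nat \<Rightarrow> complex) set) space_with_functions" where
  "subspace_of_grassmann_bundle d n Z =
     (let F = subspace_of_affine (frame_index d n) (frame_preimage d n Z) in \<lparr>
        points = Z,
        opens = {U. U \<subseteq> Z \<and> frame_preimage d n U \<in> opens F},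
        regular = (\<lambda>U. {f. f \<circ> frame_quotient d \<in> regular F (frame_preimage d n U)})\<rparr>)"


section \<open>Nash modifications\<close>

definition gauss_graph ::
  "nat \<Rightarrow> nat \<Rightarrow> (nat \<Rightarrow> complex) set \<Rightarrow> ((nat \<Rightarrow> complex) \<times> (nat \<Rightarrow> complex) set) set" where
  "gauss_graph n d X = (\<lambda>x. (x, tangent_space n X x)) ` (X - singular_locus n d X)"

definition nash_closure ::
  "nat \<Rightarrow> nat \<Rightarrow> (nat \<Rightarrow> complex) set \<Rightarrow> ((nat \<Rightarrow> complex) \<times> (nat \<Rightarrow> complex) set) set" where
  "nash_closure n d X = (let P = X \<times> grassmannian d n in
     \<Inter>{Z. Z \<subseteq> P \<and> gauss_graph n d X \<subseteq> Z \<and>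
         P - Z \<in> opens (subspace_of_grassmann_bundle d n P)})"

text \<open>
  Nash modifications are considered up to isomorphism over \<open>X\<close>, so that the construction, which
  starts from a variety in an affine space, can be iterated: \<open>(Y, \<nu>)\<close> is a model, closed in
  \<open>\<complex>\<^sup>m\<close>, of the Nash modification of \<open>X\<close>.
\<close>

definition nash_modification ::
  "nat \<Rightarrow> (nat \<Rightarrow> complex) set \<Rightarrow> nat \<Rightarrow> (nat \<Rightarrow> complex) set \<Rightarrow>
   ((nat \<Rightarrow> complex) \<Rightarrow> (nat \<Rightarrow> complex)) \<Rightarrow> bool" where
  "nash_modification n X m Y \<nu> \<longleftrightarrow> algebraic_set {..<m} Y \<and>
     (\<exists>d. equidimensional {..<n} d X \<and>
       (\<exists>\<phi>. isomorphism (subspace_of_grassmann_bundle d n (nash_closure n d X))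
               (subspace_of_affine {..<m} Y) \<phi> \<and>
             (\<forall>z\<in>nash_closure n d X. \<nu> (\<phi> z) = fst z)))"

inductive iterated_nash_modification ::
  "nat \<Rightarrow> (nat \<Rightarrow> complex) set \<Rightarrow> nat \<Rightarrow> nat \<Rightarrow> (nat \<Rightarrow> complex) set \<Rightarrow>
   ((nat \<Rightarrow> complex) \<Rightarrow> (nat \<Rightarrow> complex)) \<Rightarrow> bool"
  for n :: nat and X :: "(nat \<Rightarrow> complex) set" where
  zero: "iterated_nash_modification n X 0 n X id"
| step: "iterated_nash_modification n X k m Y \<mu> \<Longrightarrow> nash_modification m Y l Z \<nu> \<Longrightarrow>
    iterated_nash_modification n X (Suc k) l Z (\<mu> \<circ> \<nu>)"


section \<open>Toric curves\<close>

definition toric_degree :: "nat \<Rightarrow> (nat \<Rightarrow> int) \<Rightarrow> (nat \<Rightarrow>\<^sub>0 nat) \<Rightarrow> int" where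
  "toric_degree n a \<alpha> = (\<Sum>i<n. int (Poly_Mapping.lookup \<alpha> i) * a i)"

definition toric_ideal :: "nat \<Rightarrow> (nat \<Rightarrow> int) \<Rightarrow> nat mpoly set" where
  "toric_ideal n a = ideal_generated {..<n}
     {Poly_Mapping.single \<alpha> 1 - Poly_Mapping.single \<beta> 1 | \<alpha> \<beta>.
        Poly_Mapping.keys \<alpha> \<subseteq> {..<n} \<and> Poly_Mapping.keys \<beta> \<subseteq> {..<n} \<and>
        toric_degree n a \<alpha> = toric_degree n a \<beta>}"

definition toric_curve :: "nat \<Rightarrow> (nat \<Rightarrow> int) \<Rightarrow> (nat \<Rightarrow> complex) set" where
  "toric_curve n a = zero_locus {..<n} (toric_ideal n a)"

end

theory Submission
  imports Defs "HOL-Computational_Algebra.Polynomial"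
begin

text \<open>
  The curve \<open>toric_curve n a\<close> is the image of \<open>t \<mapsto> (t ^ e\<^sub>i)\<^sub>i\<close> for the exponents \<open>e\<^sub>i = a i\<close>: a
  point of the torus at which all binomials vanish has a parameter because the exponents have
  greatest common divisor \<open>1\<close> (\<open>toric_curve_eq_monomial_curve\<close>).  Hence restricting a polynomial
  to the curve gives a polynomial in \<open>t\<close>, proper closed subsets are finite, and the curve is
  irreducible of dimension one.

  Let \<open>e\<^sub>m\<close> be the smallest exponent.  At the parameter \<open>t \<noteq> 0\<close> the tangent space is the line through
  \<open>v(t) = (e\<^sub>i t ^ (e\<^sub>i - e\<^sub>m))\<^sub>i\<close>, a vector that has a nonzero limit at \<open>t = 0\<close>.  So the closure of the
  graph of the Gauss map consists of the pairs of the point with parameter \<open>t\<close> and the line through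
  \<open>v(t)\<close>, for all \<open>t\<close> (\<open>nash_closure_monomial_curve\<close>).  The line is determined by the slopes
  \<open>v\<^sub>i / v\<^sub>m\<close>, constant multiples of \<open>t ^ (e\<^sub>i - e\<^sub>m)\<close>, so the coordinates \<open>t ^ e\<^sub>m\<close> and
  \<open>t ^ (e\<^sub>i - e\<^sub>m)\<close> identify the closure with the monomial curve whose exponents are \<open>e\<^sub>m\<close> and the
  positive differences \<open>e\<^sub>i - e\<^sub>m\<close> (\<open>nash_modification_monomial_curve\<close>).

  If \<open>e\<^sub>m = 1\<close>, the description of the tangent space by \<open>v(t)\<close> also holds at \<open>t = 0\<close> and the curve is
  nonsingular.  If \<open>e\<^sub>m > 1\<close>, the exponents are not all equal, and subtracting \<open>e\<^sub>m\<close> lowers their sum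
  (\<open>sum_nash_weights_less\<close>).  This is the subtractive Euclidean algorithm, so the process stops, and
  it can only stop at a nonsingular curve.

  The isomorphism is built from two facts on maps between spaces with functions: maps with pole-free
  rational coordinates are morphisms (\<open>morphism_rational\<close>), and morphisms from and to the Grassmann
  bundle can be checked on the level of frames.
\<close>

section \<open>Polynomial and rational functions\<close>

definition monomial_eval :: "('v \<Rightarrow>\<^sub>0 nat) \<Rightarrow> ('v \<Rightarrow> complex) \<Rightarrow> complex" where
  "monomial_eval \<alpha> x = (\<Prod>i\<in>Poly_Mapping.keys \<alpha>. x i ^ Poly_Mapping.lookup \<alpha> i)"

lemma monomial_eval_superset:
  assumes "finite A" "Poly_Mapping.keys \<alpha> \<subseteq> A"
  shows "monomial_eval \<alpha> x = (\<Prod>i\<in>A. x i ^ Poly_Mapping.lookup \<alpha> i)"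
  unfolding monomial_eval_def
  by (rule prod.mono_neutral_left) (use assms in \<open>auto simp: in_keys_iff\<close>)

lemma monomial_eval_zero [simp]: "monomial_eval 0 x = 1"
  by (simp add: monomial_eval_def)

lemma monomial_eval_single [simp]: "monomial_eval (Poly_Mapping.single i k) x = x i ^ k"
  by (simp add: monomial_eval_def)

lemma monomial_eval_add: "monomial_eval (\<alpha> + \<beta>) x = monomial_eval \<alpha> x * monomial_eval \<beta> x"
proof -
  let ?A = "Poly_Mapping.keys \<alpha> \<union> Poly_Mapping.keys \<beta>"
  have "Poly_Mapping.keys (\<alpha> + \<beta>) \<subseteq> ?A" by (rule Poly_Mapping.keys_add)
  then have "monomial_eval (\<alpha> + \<beta>) x = (\<Prod>i\<in>?A. x i ^ Poly_Mapping.lookup (\<alpha> + \<beta>) i)"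
    by (intro monomial_eval_superset) auto
  also have "\<dots> = (\<Prod>i\<in>?A. x i ^ Poly_Mapping.lookup \<alpha> i) * (\<Prod>i\<in>?A. x i ^ Poly_Mapping.lookup \<beta> i)"
    by (simp add: lookup_add power_add prod.distrib)
  also have "\<dots> = monomial_eval \<alpha> x * monomial_eval \<beta> x"
    by (simp add: monomial_eval_superset[of ?A])
  finally show ?thesis .
qed

lemma poly_eval_superset:
  assumes "finite A" "Poly_Mapping.keys p \<subseteq> A"
  shows "poly_eval p x = (\<Sum>\<alpha>\<in>A. Poly_Mapping.lookup p \<alpha> * monomial_eval \<alpha> x)"
  unfolding poly_eval_def monomial_eval_def
  by (rule sum.mono_neutral_left) (use assms in \<open>auto simp: in_keys_iff\<close>)

lemma poly_eval_eq_sum: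
  "poly_eval p x = (\<Sum>\<alpha>\<in>Poly_Mapping.keys p. Poly_Mapping.lookup p \<alpha> * monomial_eval \<alpha> x)"
  by (simp add: poly_eval_superset)

lemma poly_eval_zero [simp]: "poly_eval 0 x = 0"
  by (simp add: poly_eval_def)

lemma poly_eval_single [simp]: "poly_eval (Poly_Mapping.single \<alpha> c) x = c * monomial_eval \<alpha> x"
  by (simp add: poly_eval_eq_sum)

lemma poly_eval_add: "poly_eval (p + q) x = poly_eval p x + poly_eval q x"
proof -
  let ?A = "Poly_Mapping.keys p \<union> Poly_Mapping.keys q"
  have "Poly_Mapping.keys (p + q) \<subseteq> ?A" by (rule Poly_Mapping.keys_add)
  then show ?thesis
    by (simp add: poly_eval_superset[of ?A] lookup_add distrib_right sum.distrib)
qed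

lemma poly_eval_diff: "poly_eval (p - q) x = poly_eval p x - poly_eval q x"
  using poly_eval_add[of "p - q" q x] by simp

lemma poly_eval_sum: "poly_eval (sum f A) x = (\<Sum>a\<in>A. poly_eval (f a) x)"
  by (induction A rule: infinite_finite_induct) (simp_all add: poly_eval_add)

lemma sum_of_terms:
  "(\<Sum>\<alpha>\<in>Poly_Mapping.keys p. Poly_Mapping.single \<alpha> (Poly_Mapping.lookup p \<alpha>)) = p"
  by (rule poly_mapping_eqI)
    (auto simp: lookup_sum lookup_single when_def in_keys_iff)

lemma poly_eval_mult: "poly_eval (p * q) x = poly_eval p x * poly_eval q x"
proof -
  let ?s = "\<lambda>p \<alpha>. Poly_Mapping.single \<alpha> (Poly_Mapping.lookup p \<alpha>)"
  have "p * q = (\<Sum>\<alpha>\<in>Poly_Mapping.keys p. ?s p \<alpha>) * (\<Sum>\<beta>\<in>Poly_Mapping.keys q. ?s q \<beta>)"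
    by (simp only: sum_of_terms)
  also have "\<dots> = (\<Sum>\<alpha>\<in>Poly_Mapping.keys p. \<Sum>\<beta>\<in>Poly_Mapping.keys q. ?s p \<alpha> * ?s q \<beta>)"
    by (rule sum_product)
  finally have "poly_eval (p * q) x = (\<Sum>\<alpha>\<in>Poly_Mapping.keys p. \<Sum>\<beta>\<in>Poly_Mapping.keys q.
      (Poly_Mapping.lookup p \<alpha> * monomial_eval \<alpha> x) * (Poly_Mapping.lookup q \<beta> * monomial_eval \<beta> x))"
    by (simp add: poly_eval_sum mult_single monomial_eval_add mult_ac)
  also have "\<dots> = poly_eval p x * poly_eval q x"
    by (simp add: poly_eval_eq_sum sum_product)
  finally show ?thesis .
qed

lemma poly_ring_single: "Poly_Mapping.keys \<alpha> \<subseteq> I \<Longrightarrow> Poly_Mapping.single \<alpha> c \<in> poly_ring I"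
  by (auto simp: poly_ring_def split: if_splits)

lemma poly_ring_add: "p \<in> poly_ring I \<Longrightarrow> q \<in> poly_ring I \<Longrightarrow> p + q \<in> poly_ring I"
  using Poly_Mapping.keys_add[of p q] by (fastforce simp: poly_ring_def)

lemma poly_ring_mult:
  assumes "p \<in> poly_ring I" "q \<in> poly_ring I"
  shows "p * q \<in> poly_ring I"
proof -
  have "Poly_Mapping.keys (\<alpha> + \<beta>) \<subseteq> I"
    if "\<alpha> \<in> Poly_Mapping.keys p" "\<beta> \<in> Poly_Mapping.keys q" for \<alpha> \<beta>
    using Poly_Mapping.keys_add[of \<alpha> \<beta>] that assms by (fastforce simp: poly_ring_def)
  then show ?thesis
    using Poly_Mapping.keys_mult[of p q] by (fastforce simp: poly_ring_def)
qed

lemma poly_ring_diff: "p \<in> poly_ring I \<Longrightarrow> q \<in> poly_ring I \<Longrightarrow> p - q \<in> poly_ring I"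
  using keys_diff[of p q] by (fastforce simp: poly_ring_def)

text \<open>
  Any class of functions that is closed under the ring operations and contains the coordinates
  of a map \<open>\<Phi>\<close> contains the pullbacks of all polynomials along \<open>\<Phi>\<close>.  This one observation serves
  both for polynomials in a parameter and for quotients of polynomials.
\<close>

lemma poly_eval_pullback_induct:
  assumes p: "p \<in> poly_ring J"
    and const: "\<And>c. Q (\<lambda>_. c)"
    and add: "\<And>f g. Q f \<Longrightarrow> Q g \<Longrightarrow> Q (\<lambda>y. f y + g y)"
    and mult: "\<And>f g. Q f \<Longrightarrow> Q g \<Longrightarrow> Q (\<lambda>y. f y * g y)"
    and coord: "\<And>j. j \<in> J \<Longrightarrow> Q (\<lambda>y. \<Phi> y j)"
  shows "Q (\<lambda>y. poly_eval p (\<Phi> y))"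
proof -
  have pow: "Q (\<lambda>y. f y ^ k)" if "Q f" for f k
    by (induction k) (auto intro: const mult that)
  have prod: "Q (\<lambda>y. \<Prod>i\<in>A. f i y)" if "\<And>i. i \<in> A \<Longrightarrow> Q (f i)" for A and f :: "'a \<Rightarrow> 'b \<Rightarrow> complex"
    using that by (induction A rule: infinite_finite_induct) (auto intro: const mult)
  have sum: "Q (\<lambda>y. \<Sum>i\<in>A. f i y)" if "\<And>i. i \<in> A \<Longrightarrow> Q (f i)"
    for A and f :: "('a \<Rightarrow>\<^sub>0 nat) \<Rightarrow> 'b \<Rightarrow> complex"
    using that by (induction A rule: infinite_finite_induct) (auto intro: const add)
  show ?thesis
    unfolding poly_eval_def
    by (intro sum mult const prod pow coord) (use p in \<open>auto simp: poly_ring_def\<close>)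
qed

definition polynomial_function :: "'v set \<Rightarrow> (('v \<Rightarrow> complex) \<Rightarrow> complex) \<Rightarrow> bool" where
  "polynomial_function I f \<longleftrightarrow> (\<exists>p\<in>poly_ring I. f = poly_eval p)"

lemma polynomial_function_const: "polynomial_function I (\<lambda>_. c)"
  unfolding polynomial_function_def
  by (rule bexI[of _ "Poly_Mapping.single 0 c"]) (auto simp: poly_ring_single fun_eq_iff)

lemma polynomial_function_coord: "i \<in> I \<Longrightarrow> polynomial_function I (\<lambda>x. x i)"
  unfolding polynomial_function_def
  by (rule bexI[of _ "Poly_Mapping.single (Poly_Mapping.single i 1) 1"])
    (auto simp: poly_ring_single fun_eq_iff)

lemma polynomial_function_add:
  "polynomial_function I f \<Longrightarrow> polynomial_function I g \<Longrightarrow> polynomial_function I (\<lambda>x. f x + g x)"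
  unfolding polynomial_function_def
  by (metis (no_types, lifting) ext poly_eval_add poly_ring_add)

lemma polynomial_function_diff:
  "polynomial_function I f \<Longrightarrow> polynomial_function I g \<Longrightarrow> polynomial_function I (\<lambda>x. f x - g x)"
  unfolding polynomial_function_def
  by (metis (no_types, lifting) ext poly_eval_diff poly_ring_diff)

lemma polynomial_function_mult:
  "polynomial_function I f \<Longrightarrow> polynomial_function I g \<Longrightarrow> polynomial_function I (\<lambda>x. f x * g x)"
  unfolding polynomial_function_def
  by (metis (no_types, lifting) ext poly_eval_mult poly_ring_mult)

lemma polynomial_function_power:
  "polynomial_function I f \<Longrightarrow> polynomial_function I (\<lambda>x. f x ^ k)"
  by (induction k) (auto intro: polynomial_function_const polynomial_function_mult)

lemmas polynomial_function_intros =
  polynomial_function_const polynomial_function_coord polynomial_function_add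
  polynomial_function_diff polynomial_function_mult polynomial_function_power

definition rational_on ::
  "'v set \<Rightarrow> ('v \<Rightarrow> complex) set \<Rightarrow> (('v \<Rightarrow> complex) \<Rightarrow> complex) \<Rightarrow> bool" where
  "rational_on I D f \<longleftrightarrow> (\<exists>g h. polynomial_function I g \<and> polynomial_function I h \<and>
     (\<forall>y\<in>D. h y \<noteq> 0 \<and> f y = g y / h y))"

lemma rational_onI:
  assumes "polynomial_function I g" "polynomial_function I h"
    and "\<And>y. y \<in> D \<Longrightarrow> h y \<noteq> 0" "\<And>y. y \<in> D \<Longrightarrow> f y = g y / h y"
  shows "rational_on I D f"
  using assms unfolding rational_on_def by blast

lemma rational_on_polynomial:
  assumes "polynomial_function I g" "\<And>y. y \<in> D \<Longrightarrow> f y = g y"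
  shows "rational_on I D f"
  by (rule rational_onI[of I g "\<lambda>_. 1"]) (auto intro: assms polynomial_function_const)

lemma rational_on_subset: "rational_on I D f \<Longrightarrow> D' \<subseteq> D \<Longrightarrow> rational_on I D' f"
  unfolding rational_on_def by blast

lemma rational_on_add:
  assumes "rational_on I D f" "rational_on I D g"
  shows "rational_on I D (\<lambda>y. f y + g y)"
proof -
  obtain f1 f2 g1 g2 where
    "polynomial_function I f1" "polynomial_function I f2"
    "polynomial_function I g1" "polynomial_function I g2"
    "\<forall>y\<in>D. f2 y \<noteq> 0 \<and> f y = f1 y / f2 y" "\<forall>y\<in>D. g2 y \<noteq> 0 \<and> g y = g1 y / g2 y"
    using assms unfolding rational_on_def by blast
  then show ?thesis
    by (intro rational_onI[of I "\<lambda>y. f1 y * g2 y + g1 y * f2 y" "\<lambda>y. f2 y * g2 y"])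
      (auto intro!: polynomial_function_intros simp: add_frac_eq)
qed

lemma rational_on_mult:
  assumes "rational_on I D f" "rational_on I D g"
  shows "rational_on I D (\<lambda>y. f y * g y)"
proof -
  obtain f1 f2 g1 g2 where
    "polynomial_function I f1" "polynomial_function I f2"
    "polynomial_function I g1" "polynomial_function I g2"
    "\<forall>y\<in>D. f2 y \<noteq> 0 \<and> f y = f1 y / f2 y" "\<forall>y\<in>D. g2 y \<noteq> 0 \<and> g y = g1 y / g2 y"
    using assms unfolding rational_on_def by blast
  then show ?thesis
    by (intro rational_onI[of I "\<lambda>y. f1 y * g1 y" "\<lambda>y. f2 y * g2 y"])
      (auto intro!: polynomial_function_intros)
qed

lemma rational_on_divide:
  assumes "rational_on I D f" "rational_on I D g" "\<And>y. y \<in> D \<Longrightarrow> g y \<noteq> 0"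
  shows "rational_on I D (\<lambda>y. f y / g y)"
proof -
  obtain f1 f2 g1 g2 where
    "polynomial_function I f1" "polynomial_function I f2"
    "polynomial_function I g1" "polynomial_function I g2"
    "\<forall>y\<in>D. f2 y \<noteq> 0 \<and> f y = f1 y / f2 y" "\<forall>y\<in>D. g2 y \<noteq> 0 \<and> g y = g1 y / g2 y"
    using assms unfolding rational_on_def by blast
  then show ?thesis
    using assms(3)
    by (intro rational_onI[of I "\<lambda>y. f1 y * g2 y" "\<lambda>y. f2 y * g1 y"])
      (auto intro!: polynomial_function_intros)
qed

lemma rational_on_poly_eval:
  assumes "p \<in> poly_ring J" "\<And>j. j \<in> J \<Longrightarrow> rational_on I D (\<lambda>y. \<Phi> y j)"
  shows "rational_on I D (\<lambda>y. poly_eval p (\<Phi> y))"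
  using assms(1)
  by (rule poly_eval_pullback_induct[where Q = "rational_on I D"])
    (auto intro: rational_on_add rational_on_mult assms(2)
      rational_on_polynomial polynomial_function_const)

section \<open>Zariski open sets and rational maps\<close>

lemma mem_zariski_opensI:
  assumes "D \<subseteq> coord_space I" "\<And>f. f \<in> F \<Longrightarrow> polynomial_function I f"
    and "U = {y\<in>D. \<exists>f\<in>F. f y \<noteq> 0}"
  shows "U \<in> zariski_opens I D"
proof -
  let ?S = "{p\<in>poly_ring I. poly_eval p \<in> F}"
  have "U = D - zero_locus I ?S"
    using assms by (fastforce simp: zero_locus_def polynomial_function_def)
  then show ?thesis
    unfolding zariski_opens_def by blast
qed

lemma zariski_opens_nonvanishing:
  assumes "U \<in> zariski_opens I D" "D \<subseteq> coord_space I"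
  obtains S where "S \<subseteq> poly_ring I" "U = {y\<in>D. \<exists>p\<in>S. poly_eval p y \<noteq> 0}"
  using assms unfolding zariski_opens_def zero_locus_def by blast

lemma zariski_opens_subset: "U \<in> zariski_opens I D \<Longrightarrow> U \<subseteq> D"
  unfolding zariski_opens_def by blast

text \<open>
  On \<open>D\<close> each polynomial pulls back to a quotient whose denominator has no zeros there, so the
  preimage of a nonvanishing set is the nonvanishing set of the numerators.
\<close>

lemma zariski_opens_vimage:
  assumes D: "D \<subseteq> coord_space I" and E: "E \<subseteq> coord_space J" and maps: "\<Phi> ` D \<subseteq> E"
    and rat: "\<And>j. j \<in> J \<Longrightarrow> rational_on I D (\<lambda>y. \<Phi> y j)"
    and V: "V \<in> zariski_opens J E"
  shows "\<Phi> -` V \<inter> D \<in> zariski_opens I D"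
proof -
  obtain S where S: "S \<subseteq> poly_ring J" and V_eq: "V = {y\<in>E. \<exists>p\<in>S. poly_eval p y \<noteq> 0}"
    using zariski_opens_nonvanishing[OF V E] .
  have "\<forall>p\<in>S. rational_on I D (\<lambda>y. poly_eval p (\<Phi> y))"
    using S rat by (blast intro: rational_on_poly_eval)
  then obtain g h where gh: "\<And>p. p \<in> S \<Longrightarrow> polynomial_function I (g p)"
    "\<And>p y. p \<in> S \<Longrightarrow> y \<in> D \<Longrightarrow> h p y \<noteq> 0 \<and> poly_eval p (\<Phi> y) = g p y / h p y"
    unfolding rational_on_def by metis
  show ?thesis
    by (rule mem_zariski_opensI[OF D, of "g ` S"])
      (use gh V_eq maps in \<open>auto simp: image_subset_iff\<close>)
qed

text \<open>
  The criterion behind both halves of the isomorphism: a map whose coordinates are quotients of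
  polynomials without poles on \<open>D\<close> is a morphism, because locally regular functions \<open>g / h\<close> pull
  back to quotients of quotients.
\<close>

lemma morphism_rational:
  assumes D: "D \<subseteq> coord_space I" and E: "E \<subseteq> coord_space J" and maps: "\<Phi> ` D \<subseteq> E"
    and rat: "\<And>j. j \<in> J \<Longrightarrow> rational_on I D (\<lambda>y. \<Phi> y j)"
  shows "morphism (subspace_of_affine I D) (subspace_of_affine J E) \<Phi>"
proof -
  have "f \<circ> \<Phi> \<in> regular (subspace_of_affine I D) (\<Phi> -` V \<inter> D)"
    if V: "V \<in> zariski_opens J E" and f: "f \<in> regular (subspace_of_affine J E) V" for V f
  proof -
    let ?U = "\<Phi> -` V \<inter> D"
    have "\<exists>W\<in>zariski_opens I ?U. \<exists>g\<in>poly_ring I. \<exists>h\<in>poly_ring I.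
        y \<in> W \<and> (\<forall>z\<in>W. poly_eval h z \<noteq> 0 \<and> (f \<circ> \<Phi>) z = poly_eval g z / poly_eval h z)"
      if "y \<in> ?U" for y
    proof -
      have "\<Phi> y \<in> V" using that by simp
      then obtain V' g h where V': "V' \<in> zariski_opens J V" and gh: "g \<in> poly_ring J" "h \<in> poly_ring J"
        and y: "\<Phi> y \<in> V'" and eq: "\<forall>x\<in>V'. poly_eval h x \<noteq> 0 \<and> f x = poly_eval g x / poly_eval h x"
        using f unfolding subspace_of_affine_def by fastforce
      let ?W = "\<Phi> -` V' \<inter> ?U"
      have W: "?W \<in> zariski_opens I ?U"
        by (rule zariski_opens_vimage[OF _ _ _ _ V'])
          (use D E zariski_opens_subset[OF V] in \<open>auto intro: rational_on_subset[OF rat]\<close>)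
      have "rational_on I ?W (\<lambda>z. poly_eval g (\<Phi> z) / poly_eval h (\<Phi> z))"
        using eq by (intro rational_on_divide rational_on_poly_eval[OF gh(1)]
            rational_on_poly_eval[OF gh(2)] rational_on_subset[OF rat]) auto
      then obtain g' h' where "g' \<in> poly_ring I" "h' \<in> poly_ring I"
        "\<forall>z\<in>?W. poly_eval h' z \<noteq> 0 \<and>
           poly_eval g (\<Phi> z) / poly_eval h (\<Phi> z) = poly_eval g' z / poly_eval h' z"
        unfolding rational_on_def polynomial_function_def by blast
      then show ?thesis
        using W y that eq by (intro bexI[of _ ?W] bexI[of _ g'] bexI[of _ h']) auto
    qed
    then show ?thesis
      by (simp add: subspace_of_affine_def)
  qed
  then show ?thesis
    using zariski_opens_vimage[OF D E maps rat] maps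
    by (auto simp: morphism_def subspace_of_affine_def)
qed

section \<open>Finite algebraic sets\<close>

lemma polynomial_function_prod:
  "(\<And>a. a \<in> A \<Longrightarrow> polynomial_function I (f a)) \<Longrightarrow> polynomial_function I (\<lambda>x. \<Prod>a\<in>A. f a x)"
  by (induction A rule: infinite_finite_induct)
    (auto intro: polynomial_function_const polynomial_function_mult)

lemma algebraic_setI:
  assumes "\<And>f. f \<in> F \<Longrightarrow> polynomial_function I f" "X = {x\<in>coord_space I. \<forall>f\<in>F. f x = 0}"
  shows "algebraic_set I X"
proof -
  let ?S = "{p\<in>poly_ring I. poly_eval p \<in> F}"
  have "X = zero_locus I ?S"
    unfolding assms(2) zero_locus_def
  proof (intro Collect_cong conj_cong refl)
    fix x show "(\<forall>f\<in>F. f x = 0) \<longleftrightarrow> (\<forall>p\<in>?S. poly_eval p x = 0)"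
      using assms(1) by (auto simp: polynomial_function_def)
  qed
  then show ?thesis
    unfolding algebraic_set_def by (intro exI[of _ ?S]) simp
qed

text \<open>
  A point outside a finite set \<open>Z\<close> is separated from it by a product of linear forms, one for
  each point of \<open>Z\<close>.
\<close>

lemma algebraic_set_finite:
  assumes "finite Z" "Z \<subseteq> coord_space I"
  shows "algebraic_set I Z"
proof -
  let ?F = "{f. polynomial_function I f \<and> (\<forall>z\<in>Z. f z = 0)}"
  have "y \<in> Z" if y: "y \<in> coord_space I" and van: "\<forall>f\<in>?F. f y = 0" for y
  proof (rule ccontr)
    assume "y \<notin> Z"
    have "\<exists>i\<in>I. z i \<noteq> y i" if "z \<in> Z" for z
    proof -
      have "z \<noteq> y" using that \<open>y \<notin> Z\<close> by blast
      then obtain i where "z i \<noteq> y i" by blast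
      moreover have "i \<in> I"
        using calculation y that assms(2) by (force simp: coord_space_def)
      ultimately show ?thesis by blast
    qed
    then obtain c where c: "\<And>z. z \<in> Z \<Longrightarrow> c z \<in> I \<and> z (c z) \<noteq> y (c z)" by metis
    let ?f = "\<lambda>x. \<Prod>z\<in>Z. x (c z) - z (c z)"
    have "polynomial_function I ?f"
      by (intro polynomial_function_prod polynomial_function_diff polynomial_function_coord
          polynomial_function_const) (use c in blast)
    moreover have "\<forall>z\<in>Z. ?f z = 0"
      using assms(1) by auto
    ultimately have "?f y = 0" by (intro bspec[OF van]) simp
    then show False using assms(1) c by (fastforce simp: prod_zero_iff)
  qed
  then have "Z = {x\<in>coord_space I. \<forall>f\<in>?F. f x = 0}"
    using assms(2) by blast
  then show ?thesis
    by (rule algebraic_setI[rotated]) blast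
qed

lemma irreducible_set_singleton:
  "x \<in> coord_space I \<Longrightarrow> irreducible_set I {x}"
  unfolding irreducible_set_def using algebraic_set_finite[of "{x}" I]
  by (auto simp: insert_eq_iff singleton_Un_iff)

lemma irreducible_set_finite_imp_singleton:
  assumes "irreducible_set I Z" "finite Z"
  obtains x where "Z = {x}"
proof -
  obtain x where x: "x \<in> Z" using assms unfolding irreducible_set_def by blast
  have "Z \<subseteq> coord_space I"
    using assms(1) by (auto simp: irreducible_set_def algebraic_set_def zero_locus_def)
  then have "algebraic_set I {x}" "algebraic_set I (Z - {x})"
    using x assms(2) by (auto intro!: algebraic_set_finite)
  moreover have "Z = {x} \<union> (Z - {x})" using x by blast
  ultimately have "Z = {x} \<or> Z = Z - {x}"
    using assms(1) unfolding irreducible_set_def by blast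
  then show ?thesis using x that by blast
qed

section \<open>Polynomials in one parameter\<close>

text \<open>
  All limit and finiteness arguments below reduce to the fact that a polynomial in one variable has
  finitely many zeros or vanishes identically.
\<close>

definition parameter_polynomial :: "(complex \<Rightarrow> complex) \<Rightarrow> bool" where
  "parameter_polynomial f \<longleftrightarrow> (\<exists>q. f = poly q)"

lemma parameter_polynomial_const: "parameter_polynomial (\<lambda>_. c)"
  unfolding parameter_polynomial_def by (rule exI[of _ "[:c:]"]) auto

lemma parameter_polynomial_monomial: "parameter_polynomial (\<lambda>t. c * t ^ k)"
  unfolding parameter_polynomial_def by (rule exI[of _ "monom c k"]) (auto simp: poly_monom)

lemma parameter_polynomial_add:
  "parameter_polynomial f \<Longrightarrow> parameter_polynomial g \<Longrightarrow> parameter_polynomial (\<lambda>t. f t + g t)"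
  unfolding parameter_polynomial_def by (metis (no_types, lifting) ext poly_add)

lemma parameter_polynomial_mult:
  "parameter_polynomial f \<Longrightarrow> parameter_polynomial g \<Longrightarrow> parameter_polynomial (\<lambda>t. f t * g t)"
  unfolding parameter_polynomial_def by (metis (no_types, lifting) ext poly_mult)

lemma parameter_polynomial_sum:
  "(\<And>a. a \<in> A \<Longrightarrow> parameter_polynomial (f a)) \<Longrightarrow> parameter_polynomial (\<lambda>t. \<Sum>a\<in>A. f a t)"
  by (induction A rule: infinite_finite_induct)
    (auto intro: parameter_polynomial_const parameter_polynomial_add)

lemma parameter_polynomial_poly_eval:
  assumes "p \<in> poly_ring I" "\<And>i. i \<in> I \<Longrightarrow> parameter_polynomial (\<lambda>t. x t i)"
  shows "parameter_polynomial (\<lambda>t. poly_eval p (x t))"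
  using assms(1)
  by (rule poly_eval_pullback_induct[where Q = parameter_polynomial])
    (auto intro: parameter_polynomial_const parameter_polynomial_add parameter_polynomial_mult assms(2))

lemma parameter_polynomial_finite_zeros:
  assumes "parameter_polynomial f" "f s \<noteq> 0"
  shows "finite {t. f t = 0}"
proof -
  obtain q where "f = poly q" using assms(1) unfolding parameter_polynomial_def by blast
  then show ?thesis using poly_roots_finite[of q] assms(2) by (cases "q = 0") auto
qed

text \<open>Algebraic form of passing to the limit \<open>t \<rightarrow> 0\<close>.\<close>

lemma parameter_polynomial_eq_0:
  assumes "parameter_polynomial f" "\<And>t. t \<noteq> 0 \<Longrightarrow> f t = 0"
  shows "f t = 0"
proof (rule ccontr)
  assume "f t \<noteq> 0"
  then have "finite {t. f t = 0}" using parameter_polynomial_finite_zeros assms(1) by blast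
  then have "finite (insert 0 {t. f t = 0})" by simp
  moreover have "insert 0 {t. f t = 0} = UNIV" using assms(2) by blast
  ultimately show False using infinite_UNIV_char_0[where 'a = complex] by simp
qed

section \<open>Monomial curves\<close>

definition curve_point :: "nat \<Rightarrow> (nat \<Rightarrow> nat) \<Rightarrow> complex \<Rightarrow> nat \<Rightarrow> complex" where
  "curve_point n e t = (\<lambda>i. if i < n then t ^ e i else 0)"

abbreviation monomial_curve :: "nat \<Rightarrow> (nat \<Rightarrow> nat) \<Rightarrow> (nat \<Rightarrow> complex) set" where
  "monomial_curve n e \<equiv> range (curve_point n e)"

text \<open>
  Repetitions are allowed and the order is arbitrary: subtracting the smallest weight from the
  others may destroy the order and create a weight that is already present.  A repeated weight only
  repeats a coordinate of the curve.
\<close>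

definition weights :: "nat \<Rightarrow> (nat \<Rightarrow> nat) \<Rightarrow> bool" where
  "weights n e \<longleftrightarrow> (\<forall>i<n. 0 < e i) \<and> Gcd (e ` {..<n}) = 1"

lemma weights_pos: "weights n e \<Longrightarrow> i < n \<Longrightarrow> 0 < e i"
  by (simp add: weights_def)

lemma weights_nonempty: "weights n e \<Longrightarrow> 0 < n"
  by (rule ccontr) (auto simp: weights_def)

lemma curve_point_0: "weights n e \<Longrightarrow> curve_point n e 0 = (\<lambda>_. 0)"
  by (auto simp: curve_point_def weights_pos)

lemma curve_point_coord_space: "curve_point n e t \<in> coord_space {..<n}"
  by (simp add: curve_point_def coord_space_def)

lemma Gcd_bezout:
  "\<exists>u::nat \<Rightarrow> int. (\<Sum>i<n. u i * int (e i)) = int (Gcd (e ` {..<n}))"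
proof (induction n)
  case (Suc n)
  then obtain u where u: "(\<Sum>i<n. u i * int (e i)) = int (Gcd (e ` {..<n}))" by blast
  obtain p q where pq: "p * int (e n) + q * int (Gcd (e ` {..<n})) = gcd (int (e n)) (int (Gcd (e ` {..<n})))"
    using bezout_int by blast
  have "(\<Sum>i<Suc n. (if i = n then p else q * u i) * int (e i)) = q * (\<Sum>i<n. u i * int (e i)) + p * int (e n)"
    by (simp add: sum_distrib_left mult.assoc)
  also have "\<dots> = int (Gcd (e ` {..<Suc n}))"
    using pq u by (simp add: lessThan_Suc add.commute)
  finally show ?case by (rule exI[of _ "\<lambda>i. if i = n then p else q * u i"])
qed auto

lemma weights_bezout:
  assumes "weights n e"
  obtains u :: "nat \<Rightarrow> int" where "(\<Sum>i<n. u i * int (e i)) = 1"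
  using Gcd_bezout[of e n] assms by (auto simp: weights_def)

lemma prod_power_int:
  fixes t :: "'a::field"
  assumes "t \<noteq> 0"
  shows "(\<Prod>i\<in>A. t powi f i) = t powi (\<Sum>i\<in>A. f i)"
  by (induction A rule: infinite_finite_induct) (auto simp: power_int_add assms)

text \<open>
  The parameter is recovered as a Laurent monomial of the coordinates, whose exponents are Bezout
  coefficients of the weights.
\<close>

lemma curve_point_inj:
  assumes "weights n e"
  shows "inj (curve_point n e)"
proof (rule injI)
  fix s t assume "curve_point n e s = curve_point n e t"
  then have eq: "s ^ e i = t ^ e i" if "i < n" for i
    using that unfolding curve_point_def by metis
  obtain u :: "nat \<Rightarrow> int" where u: "(\<Sum>i<n. u i * int (e i)) = 1"
    using weights_bezout[OF assms] .
  have rec: "(\<Prod>i<n. (r ^ e i) powi u i) = r" if "r \<noteq> 0" for r :: complex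
  proof -
    have "(\<Prod>i<n. (r ^ e i) powi u i) = (\<Prod>i<n. r powi (int (e i) * u i))"
      by (simp add: power_int_mult)
    then show ?thesis using u by (simp add: prod_power_int that mult.commute)
  qed
  have "s = 0 \<longleftrightarrow> t = 0"
    using eq[of 0] weights_pos[OF assms, of 0] weights_nonempty[OF assms]
    by (metis power_eq_0_iff)
  moreover have "(\<Prod>i<n. (s ^ e i) powi u i) = (\<Prod>i<n. (t ^ e i) powi u i)"
    by (rule prod.cong) (simp_all add: eq)
  ultimately show "s = t"
    using rec[of s] rec[of t] by (cases "s = 0") simp_all
qed

text \<open>
  A point of the torus at which all binomials \<open>x\<^sup>\<alpha> - x\<^sup>\<beta>\<close> of the toric ideal vanish is a character
  of \<open>\<int>\<^sup>n\<close> that is trivial on the kernel of \<open>w \<mapsto> \<Sum> w\<^sub>i e\<^sub>i\<close>: the positive and the negative part of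
  an element of the kernel are the exponents \<open>\<alpha>\<close> and \<open>\<beta>\<close> of such a binomial.
\<close>

lemma kernel_character_trivial:
  fixes x :: "nat \<Rightarrow> complex"
  assumes nz: "\<And>i. i < n \<Longrightarrow> x i \<noteq> 0"
    and binom: "\<And>\<alpha> \<beta> :: nat \<Rightarrow> nat. (\<Sum>i<n. \<alpha> i * e i) = (\<Sum>i<n. \<beta> i * e i) \<Longrightarrow>
       (\<Prod>i<n. x i ^ \<alpha> i) = (\<Prod>i<n. x i ^ \<beta> i)"
    and w: "(\<Sum>i<n. w i * int (e i)) = 0"
  shows "(\<Prod>i<n. x i powi w i) = 1"
proof -
  let ?p = "\<lambda>i. nat (w i)" and ?q = "\<lambda>i. nat (- w i)"
  have "(\<Sum>i<n. int (?p i) * int (e i)) - (\<Sum>i<n. int (?q i) * int (e i)) = (\<Sum>i<n. w i * int (e i))"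
    unfolding sum_subtractf[symmetric] by (rule sum.cong) (auto simp: left_diff_distrib[symmetric])
  then have "int (\<Sum>i<n. ?p i * e i) = int (\<Sum>i<n. ?q i * e i)"
    using w by simp
  then have "(\<Prod>i<n. x i ^ ?p i) = (\<Prod>i<n. x i ^ ?q i)"
    using binom by (metis of_nat_eq_iff)
  moreover have "(\<Prod>i<n. x i powi w i) = (\<Prod>i<n. x i ^ ?p i / x i ^ ?q i)"
    by (rule prod.cong) (auto simp: power_int_def divide_simps)
  ultimately show ?thesis
    using nz by (simp add: prod_dividef)
qed

text \<open>
  If one coordinate vanishes, then the binomials \<open>x\<^sub>i ^ e j - x\<^sub>j ^ e i\<close> make all of them vanish, and
  the point has parameter \<open>0\<close>.  Otherwise the point lies in the torus and the Laurent monomial with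
  Bezout exponents \<open>u\<close> is its parameter, since \<open>e j * u\<close> and the \<open>j\<close>-th unit vector differ by an
  element of the kernel.
\<close>

lemma mem_monomial_curveI:
  fixes x :: "nat \<Rightarrow> complex"
  assumes e: "weights n e" and x: "x \<in> coord_space {..<n}"
    and binom: "\<And>\<alpha> \<beta> :: nat \<Rightarrow> nat. (\<Sum>i<n. \<alpha> i * e i) = (\<Sum>i<n. \<beta> i * e i) \<Longrightarrow>
       (\<Prod>i<n. x i ^ \<alpha> i) = (\<Prod>i<n. x i ^ \<beta> i)"
  shows "x \<in> monomial_curve n e"
proof (cases "\<exists>i<n. x i = 0")
  case True
  then obtain i where i: "i < n" "x i = 0" by blast
  have "x j = 0" if j: "j < n" for j
  proof -
    let ?\<alpha> = "\<lambda>k. if k = i then e j else 0" and ?\<beta> = "\<lambda>k. if k = j then e i else 0"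
    have "(\<Prod>k<n. x k ^ ?\<alpha> k) = (\<Prod>k<n. x k ^ ?\<beta> k)"
      using i j by (intro binom) (simp add: if_distrib[of "\<lambda>c. c * _"] sum.delta cong: if_cong)
    then have "x i ^ e j = x j ^ e i"
      using i j by (simp add: if_distrib[of "\<lambda>c. _ ^ c"] prod.delta cong: if_cong)
    then show ?thesis
      using i(2) weights_pos[OF e j] by (simp add: zero_power)
  qed
  then have "x = curve_point n e 0"
    using x by (auto simp: curve_point_0[OF e] coord_space_def fun_eq_iff)
  then show ?thesis by blast
next
  case False
  then have nz: "\<And>i. i < n \<Longrightarrow> x i \<noteq> 0" by blast
  obtain u :: "nat \<Rightarrow> int" where u: "(\<Sum>i<n. u i * int (e i)) = 1"
    using weights_bezout[OF e] .
  define t where "t = (\<Prod>i<n. x i powi u i)"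
  have "t ^ e j = x j" if j: "j < n" for j
  proof -
    let ?d = "\<lambda>i. if i = j then 1 else 0 :: int"
    let ?w = "\<lambda>i. u i * int (e j) - ?d i"
    have "(\<Sum>i<n. ?w i * int (e i)) = int (e j) * (\<Sum>i<n. u i * int (e i)) - (\<Sum>i<n. ?d i * int (e i))"
      by (simp add: sum_subtractf sum_distrib_left algebra_simps)
    also have "\<dots> = 0"
      using j u by (simp add: if_distrib[of "\<lambda>c. c * _"] cong: if_cong)
    finally have "(\<Prod>i<n. x i powi ?w i) = 1"
      by (intro kernel_character_trivial[OF nz binom]) auto
    moreover have "(\<Prod>i<n. x i powi (u i * int (e j))) = (\<Prod>i<n. x i powi ?w i * x i powi ?d i)"
      by (rule prod.cong) (use nz in \<open>auto simp: power_int_diff\<close>)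
    moreover have "(\<Prod>i<n. x i powi ?d i) = x j"
      using j by (simp add: if_distrib[of "\<lambda>c. _ powi c"] cong: if_cong)
    ultimately have "(\<Prod>i<n. x i powi (u i * int (e j))) = x j"
      by (simp add: prod.distrib)
    then show ?thesis
      by (simp add: t_def prod_power_distrib power_int_mult)
  qed
  then have "x = curve_point n e t"
    using x by (auto simp: curve_point_def coord_space_def fun_eq_iff)
  then show ?thesis by blast
qed

lemma monomial_eval_curve_point:
  assumes "Poly_Mapping.keys \<alpha> \<subseteq> {..<n}"
  shows "monomial_eval \<alpha> (curve_point n e t) = t ^ (\<Sum>i<n. Poly_Mapping.lookup \<alpha> i * e i)"
proof -
  have "monomial_eval \<alpha> (curve_point n e t) = (\<Prod>i<n. (t ^ e i) ^ Poly_Mapping.lookup \<alpha> i)"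
    by (simp add: monomial_eval_superset[OF _ assms] curve_point_def)
  then show ?thesis
    by (simp add: power_sum power_mult mult.commute)
qed

lemma toric_degree_of_nat:
  assumes "\<And>i. i < n \<Longrightarrow> a i = int (e i)"
  shows "toric_degree n a \<alpha> = int (\<Sum>i<n. Poly_Mapping.lookup \<alpha> i * e i)"
  using assms by (simp add: toric_degree_def)

lemma poly_eval_ideal_generated:
  assumes "p \<in> ideal_generated I S" "\<And>s. s \<in> S \<Longrightarrow> poly_eval s x = 0"
  shows "poly_eval p x = 0"
proof -
  obtain F c where "F \<subseteq> S" "p = (\<Sum>s\<in>F. c s * s)"
    using assms(1) unfolding ideal_generated_def by blast
  moreover have "\<forall>s\<in>F. poly_eval s x = 0"
    using assms(2) calculation(1) by blast
  ultimately show ?thesis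
    by (simp add: poly_eval_sum poly_eval_mult)
qed

lemma toric_curve_eq_monomial_curve:
  assumes e: "weights n e" and a: "\<And>i. i < n \<Longrightarrow> a i = int (e i)"
  shows "toric_curve n a = monomial_curve n e"
proof
  let ?B = "{Poly_Mapping.single \<alpha> 1 - Poly_Mapping.single \<beta> 1 | \<alpha> \<beta>.
        Poly_Mapping.keys \<alpha> \<subseteq> {..<n} \<and> Poly_Mapping.keys \<beta> \<subseteq> {..<n} \<and>
        toric_degree n a \<alpha> = toric_degree n a \<beta>} :: nat mpoly set"
  have "poly_eval b (curve_point n e t) = 0" if "b \<in> ?B" for b t
    using that by (auto simp: poly_eval_diff monomial_eval_curve_point toric_degree_of_nat[OF a] simp del: of_nat_sum)
  then have "poly_eval p (curve_point n e t) = 0" if "p \<in> toric_ideal n a" for p t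
    using that unfolding toric_ideal_def by (rule poly_eval_ideal_generated[rotated])
  then show "monomial_curve n e \<subseteq> toric_curve n a"
    by (auto simp: toric_curve_def zero_locus_def curve_point_coord_space)
  show "toric_curve n a \<subseteq> monomial_curve n e"
  proof
    fix x assume "x \<in> toric_curve n a"
    then have x: "x \<in> coord_space {..<n}" "\<forall>p\<in>toric_ideal n a. poly_eval p x = 0"
      by (auto simp: toric_curve_def zero_locus_def)
    have "b \<in> toric_ideal n a" if "b \<in> ?B" for b
      unfolding toric_ideal_def ideal_generated_def
      using that by (intro CollectI exI[of _ "{b}"] exI[of _ "\<lambda>_. 1"])
        (auto simp: poly_ring_def)
    then have B: "poly_eval b x = 0" if "b \<in> ?B" for b
      using x(2) that by blast
    show "x \<in> monomial_curve n e"
    proof (rule mem_monomial_curveI[OF e x(1)])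
      fix \<alpha> \<beta> :: "nat \<Rightarrow> nat"
      assume deg: "(\<Sum>i<n. \<alpha> i * e i) = (\<Sum>i<n. \<beta> i * e i)"
      define M where "M \<gamma> = (\<Sum>i<n. Poly_Mapping.single i (\<gamma> i))" for \<gamma> :: "nat \<Rightarrow> nat"
      have look: "Poly_Mapping.lookup (M \<gamma>) i = (if i < n then \<gamma> i else 0)" for \<gamma> i
        by (auto simp: M_def lookup_sum lookup_single when_def)
      have keys: "Poly_Mapping.keys (M \<gamma>) \<subseteq> {..<n}" for \<gamma>
        by (auto simp: in_keys_iff look split: if_splits)
      have "toric_degree n a (M \<alpha>) = toric_degree n a (M \<beta>)"
        using deg by (simp add: toric_degree_of_nat[OF a] look flip: of_nat_mult of_nat_sum)
      then have "poly_eval (Poly_Mapping.single (M \<alpha>) 1 - Poly_Mapping.single (M \<beta>) 1) x = 0"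
        using keys by (intro B) blast
      then show "(\<Prod>i<n. x i ^ \<alpha> i) = (\<Prod>i<n. x i ^ \<beta> i)"
        using keys by (simp add: poly_eval_diff monomial_eval_superset[of "{..<n}"] look)
    qed
  qed
qed

lemma poly_ring_zero: "0 \<in> poly_ring I"
  by (simp add: poly_ring_def)

lemma poly_ring_sum: "(\<And>a. a \<in> A \<Longrightarrow> f a \<in> poly_ring I) \<Longrightarrow> sum f A \<in> poly_ring I"
  by (induction A rule: infinite_finite_induct) (auto intro: poly_ring_add poly_ring_zero)

lemma toric_ideal_subset_poly_ring: "toric_ideal n a \<subseteq> poly_ring {..<n}"
  unfolding toric_ideal_def ideal_generated_def
  by (auto intro!: poly_ring_sum poly_ring_mult) (blast intro: poly_ring_diff poly_ring_single)

lemma algebraic_set_monomial_curve: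
  assumes "weights n e"
  shows "algebraic_set {..<n} (monomial_curve n e)"
  unfolding toric_curve_eq_monomial_curve[OF assms refl, symmetric]
  unfolding algebraic_set_def toric_curve_def
  using toric_ideal_subset_poly_ring by blast

lemma parameter_polynomial_curve_point:
  "p \<in> poly_ring {..<n} \<Longrightarrow> parameter_polynomial (\<lambda>t. poly_eval p (curve_point n e t))"
  by (rule parameter_polynomial_poly_eval, assumption)
    (use parameter_polynomial_monomial[of 1] in \<open>simp add: curve_point_def\<close>)

section \<open>Dimension of a monomial curve\<close>

text \<open>
  Some polynomial that vanishes on \<open>Z\<close> does not vanish on the whole curve.  As a function of the
  parameter it is a nonzero polynomial, which has finitely many zeros.  Irreducibility and
  dimension one of the curve both follow.
\<close>

lemma algebraic_proper_subset_finite: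
  assumes "algebraic_set {..<n} Z" "Z \<subset> monomial_curve n e"
  shows "finite Z"
proof -
  obtain S where S: "S \<subseteq> poly_ring {..<n}" "Z = zero_locus {..<n} S"
    using assms(1) unfolding algebraic_set_def by blast
  obtain s where "curve_point n e s \<notin> Z" using assms(2) by blast
  then obtain p where p: "p \<in> S" "poly_eval p (curve_point n e s) \<noteq> 0"
    using S(2) curve_point_coord_space by (auto simp: zero_locus_def)
  have "finite {t. poly_eval p (curve_point n e t) = 0}"
    using parameter_polynomial_finite_zeros[OF parameter_polynomial_curve_point] p S(1) by blast
  moreover have "Z \<subseteq> curve_point n e ` {t. poly_eval p (curve_point n e t) = 0}"
    using assms(2) S(2) p(1) by (auto simp: zero_locus_def)
  ultimately show ?thesis
    by (meson finite_imageI finite_subset)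
qed

lemma infinite_monomial_curve: "weights n e \<Longrightarrow> infinite (monomial_curve n e)"
  using range_inj_infinite infinite_UNIV_char_0 finite_imageD curve_point_inj by blast

lemma irreducible_set_monomial_curve:
  assumes "weights n e"
  shows "irreducible_set {..<n} (monomial_curve n e)"
proof -
  have "monomial_curve n e = Z1 \<or> monomial_curve n e = Z2"
    if Z: "algebraic_set {..<n} Z1" "algebraic_set {..<n} Z2" "monomial_curve n e = Z1 \<union> Z2" for Z1 Z2
  proof (rule ccontr)
    assume "\<not> (monomial_curve n e = Z1 \<or> monomial_curve n e = Z2)"
    then have "Z1 \<subset> monomial_curve n e" "Z2 \<subset> monomial_curve n e" using Z(3) by blast+
    then have "finite (Z1 \<union> Z2)" using Z(1,2) algebraic_proper_subset_finite by blast
    then show False using infinite_monomial_curve[OF assms] Z(3) by simp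
  qed
  then show ?thesis
    unfolding irreducible_set_def using algebraic_set_monomial_curve[OF assms] by blast
qed

text \<open>
  In a chain of irreducible closed subsets every member but the last is a proper subset of the
  curve, hence finite, hence a point; so there are at most two members.
\<close>

lemma krull_dim_monomial_curve:
  assumes "weights n e"
  shows "krull_dim {..<n} (monomial_curve n e) = enat 1"
proof -
  let ?Y = "monomial_curve n e" and ?I = "{..<n}"
  let ?K = "{enat k | k. \<exists>C. (\<forall>i\<le>k. irreducible_set ?I (C i) \<and> C i \<subseteq> ?Y) \<and> (\<forall>i<k. C i \<subset> C (Suc i))}"
  have "k \<le> 1" if C: "\<forall>i\<le>k. irreducible_set ?I (C i) \<and> C i \<subseteq> ?Y" "\<forall>i<k. C i \<subset> C (Suc i)" for k C
  proof (rule ccontr)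
    assume "\<not> k \<le> 1"
    then have *: "C 0 \<subset> C 1" "C 1 \<subset> C 2" "C 2 \<subseteq> ?Y" "irreducible_set ?I (C 0)" "irreducible_set ?I (C 1)"
      using C by (auto simp: numeral_2_eq_2)
    then have "finite (C 1)"
      using algebraic_proper_subset_finite unfolding irreducible_set_def by (metis psubset_subset_trans)
    then obtain x where "C 1 = {x}" using irreducible_set_finite_imp_singleton *(5) by blast
    then have "C 0 \<subset> {x}" using *(1) by simp
    then have "C 0 = {}" by blast
    then show False using *(4) by (simp add: irreducible_set_def)
  qed
  then have "Sup ?K \<le> enat 1"
    by (intro Sup_least) auto
  moreover have "enat 1 \<in> ?K"
  proof -
    let ?C = "\<lambda>i::nat. if i = 0 then {curve_point n e 0} else ?Y"
    have "?Y \<noteq> {curve_point n e 0}"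
      using infinite_monomial_curve[OF assms] by (metis finite.emptyI finite_insert)
    then have "{curve_point n e 0} \<subset> ?Y" by blast
    then show ?thesis
      using irreducible_set_monomial_curve[OF assms]
        irreducible_set_singleton[OF curve_point_coord_space[of n e 0]]
      by (intro CollectI exI[of _ 1] exI[of _ ?C] conjI refl) (simp_all add: le_Suc_eq)
  qed
  ultimately show ?thesis
    unfolding krull_dim_def by (meson Sup_upper order_antisym)
qed

lemma equidimensional_monomial_curve:
  assumes "weights n e"
  shows "equidimensional {..<n} 1 (monomial_curve n e)"
proof -
  have "Z = monomial_curve n e" if "irreducible_component {..<n} (monomial_curve n e) Z" for Z
    using that irreducible_set_monomial_curve[OF assms] unfolding irreducible_component_def by blast
  then show ?thesis
    unfolding equidimensional_def
    using algebraic_set_monomial_curve[OF assms] krull_dim_monomial_curve[OF assms] by blast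
qed

section \<open>Tangent spaces of a monomial curve\<close>

lemma poly_ring_partial_deriv:
  assumes "p \<in> poly_ring I"
  shows "partial_deriv i p \<in> poly_ring I"
  unfolding partial_deriv_def
proof (intro poly_ring_sum poly_ring_single)
  fix \<alpha> assume "\<alpha> \<in> Poly_Mapping.keys p"
  then have "Poly_Mapping.keys \<alpha> \<subseteq> I" using assms by (simp add: poly_ring_def)
  moreover have "Poly_Mapping.keys (\<alpha> - Poly_Mapping.single i 1) \<subseteq> Poly_Mapping.keys \<alpha>"
    by (auto simp: in_keys_iff lookup_minus)
  ultimately show "Poly_Mapping.keys (\<alpha> - Poly_Mapping.single i 1) \<subseteq> I" by blast
qed

lemma monomial_eval_has_field_derivative:
  assumes I: "finite I" "Poly_Mapping.keys \<alpha> \<subseteq> I"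
    and x: "\<And>i. i \<in> I \<Longrightarrow> ((\<lambda>s. x s i) has_field_derivative d i) (at t)"
  shows "((\<lambda>s. monomial_eval \<alpha> (x s)) has_field_derivative
    (\<Sum>i\<in>I. of_nat (Poly_Mapping.lookup \<alpha> i) *
       monomial_eval (\<alpha> - Poly_Mapping.single i 1) (x t) * d i)) (at t)"
proof -
  let ?l = "Poly_Mapping.lookup \<alpha>"
  have "((\<lambda>s. \<Prod>i\<in>I. x s i ^ ?l i) has_field_derivative
      (\<Sum>i\<in>I. (of_nat (?l i) * (d i * x t i ^ (?l i - Suc 0))) * (\<Prod>k\<in>I - {i}. x t k ^ ?l k))) (at t)"
    by (rule has_field_derivative_prod) (auto intro!: DERIV_power x)
  moreover have "(of_nat (?l i) * (d i * x t i ^ (?l i - Suc 0))) * (\<Prod>k\<in>I - {i}. x t k ^ ?l k) =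
      of_nat (?l i) * monomial_eval (\<alpha> - Poly_Mapping.single i 1) (x t) * d i" if i: "i \<in> I" for i
  proof -
    have "Poly_Mapping.keys (\<alpha> - Poly_Mapping.single i 1) \<subseteq> I"
      using I(2) by (auto simp: in_keys_iff lookup_minus)
    then have "monomial_eval (\<alpha> - Poly_Mapping.single i 1) (x t) =
        (\<Prod>k\<in>I. x t k ^ Poly_Mapping.lookup (\<alpha> - Poly_Mapping.single i 1) k)"
      by (rule monomial_eval_superset[OF I(1)])
    also have "\<dots> = x t i ^ (?l i - 1) *
        (\<Prod>k\<in>I - {i}. x t k ^ Poly_Mapping.lookup (\<alpha> - Poly_Mapping.single i 1) k)"
      by (simp add: prod.remove[OF I(1) i] lookup_minus)
    also have "(\<Prod>k\<in>I - {i}. x t k ^ Poly_Mapping.lookup (\<alpha> - Poly_Mapping.single i 1) k) =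
        (\<Prod>k\<in>I - {i}. x t k ^ ?l k)"
      by (rule prod.cong) (auto simp: lookup_minus lookup_single when_def)
    finally have "monomial_eval (\<alpha> - Poly_Mapping.single i 1) (x t) =
        x t i ^ (?l i - 1) * (\<Prod>k\<in>I - {i}. x t k ^ ?l k)" .
    then show ?thesis by simp
  qed
  ultimately show ?thesis
    by (simp add: monomial_eval_superset[OF I])
qed

text \<open>
  The chain rule.  Along the parametrisation it produces tangent vectors; along a straight line it
  evaluates the linear form of an explicit equation without computing its partial derivatives.
\<close>

lemma poly_eval_has_field_derivative:
  assumes "finite I" and p: "p \<in> poly_ring I"
    and x: "\<And>i. i \<in> I \<Longrightarrow> ((\<lambda>s. x s i) has_field_derivative d i) (at t)"
  shows "((\<lambda>s. poly_eval p (x s)) has_field_derivative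
    (\<Sum>i\<in>I. poly_eval (partial_deriv i p) (x t) * d i)) (at t)"
proof -
  let ?K = "Poly_Mapping.keys p"
  let ?l = "Poly_Mapping.lookup"
  let ?D = "\<lambda>\<alpha> i. of_nat (?l \<alpha> i) * monomial_eval (\<alpha> - Poly_Mapping.single i 1) (x t) * d i"
  have "((\<lambda>s. \<Sum>\<alpha>\<in>?K. ?l p \<alpha> * monomial_eval \<alpha> (x s)) has_field_derivative
      (\<Sum>\<alpha>\<in>?K. ?l p \<alpha> * (\<Sum>i\<in>I. ?D \<alpha> i))) (at t)"
    by (intro DERIV_sum DERIV_cmult monomial_eval_has_field_derivative x \<open>finite I\<close>)
      (use p in \<open>auto simp: poly_ring_def\<close>)
  moreover have "(\<Sum>\<alpha>\<in>?K. ?l p \<alpha> * (\<Sum>i\<in>I. ?D \<alpha> i)) = (\<Sum>i\<in>I. \<Sum>\<alpha>\<in>?K. ?l p \<alpha> * ?D \<alpha> i)"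
    unfolding sum_distrib_left by (rule sum.swap)
  moreover have "\<dots> = (\<Sum>i\<in>I. poly_eval (partial_deriv i p) (x t) * d i)"
    by (simp add: partial_deriv_def poly_eval_sum sum_distrib_right sum_distrib_left mult_ac)
  ultimately show ?thesis
    by (simp add: poly_eval_eq_sum[of p])
qed

text \<open>
  Up to the factor \<open>t ^ (e m - 1)\<close>, which vanishes only at \<open>t = 0\<close>, this is the velocity of the
  parametrisation.
\<close>

definition direction :: "nat \<Rightarrow> (nat \<Rightarrow> nat) \<Rightarrow> nat \<Rightarrow> complex \<Rightarrow> nat \<Rightarrow> complex" where
  "direction n e m t = (\<lambda>i. if i < n then of_nat (e i) * t ^ (e i - e m) else 0)"

definition minimal_weight :: "nat \<Rightarrow> (nat \<Rightarrow> nat) \<Rightarrow> nat \<Rightarrow> bool" where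
  "minimal_weight n e m \<longleftrightarrow> m < n \<and> (\<forall>i<n. e m \<le> e i)"

lemma direction_nonzero:
  assumes "weights n e" "minimal_weight n e m"
  shows "direction n e m t \<noteq> (\<lambda>_. 0)" "direction n e m t m = of_nat (e m)" "(of_nat (e m) :: complex) \<noteq> 0"
proof -
  have m: "m < n" "0 < e m" using assms weights_pos by (auto simp: minimal_weight_def)
  then show *: "direction n e m t m = of_nat (e m)" "(of_nat (e m) :: complex) \<noteq> 0"
    by (simp_all add: direction_def)
  show "direction n e m t \<noteq> (\<lambda>_. 0)"
  proof
    assume "direction n e m t = (\<lambda>_. 0)"
    then show False using * by simp
  qed
qed

text \<open>
  For \<open>t \<noteq> 0\<close> this is the chain rule for equations of the curve.  The pairing of a gradient with the
  direction is a polynomial in \<open>t\<close>, so the statement extends to the origin, where the direction is a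
  limit of tangent directions.
\<close>

lemma direction_tangent:
  assumes e: "weights n e" and m: "minimal_weight n e m"
  shows "direction n e m t \<in> tangent_space n (monomial_curve n e) (curve_point n e t)"
proof -
  have "(\<Sum>i<n. poly_eval (partial_deriv i f) (curve_point n e t) * direction n e m t i) = 0"
    if f: "f \<in> vanishing_ideal {..<n} (monomial_curve n e)" for f
  proof (rule parameter_polynomial_eq_0[where t = t and f =
        "\<lambda>t. \<Sum>i<n. poly_eval (partial_deriv i f) (curve_point n e t) * direction n e m t i"])
    have fR: "f \<in> poly_ring {..<n}" using f by (simp add: vanishing_ideal_def)
    show "parameter_polynomial
        (\<lambda>t. \<Sum>i<n. poly_eval (partial_deriv i f) (curve_point n e t) * direction n e m t i)"
      by (intro parameter_polynomial_sum parameter_polynomial_mult parameter_polynomial_curve_point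
          poly_ring_partial_deriv fR)
        (simp add: direction_def parameter_polynomial_monomial)
    fix t :: complex assume t: "t \<noteq> 0"
    let ?v = "\<lambda>i. t ^ (e m - 1) * direction n e m t i"
    have "((\<lambda>s. curve_point n e s i) has_field_derivative ?v i) (at t)" if i: "i \<in> {..<n}" for i
    proof -
      have "e i - Suc 0 = (e m - 1) + (e i - e m)"
        using i m weights_pos[OF e, of m] by (auto simp: minimal_weight_def)
      then have "?v i = of_nat (e i) * t ^ (e i - Suc 0)"
        using i by (simp add: direction_def power_add)
      then show ?thesis
        using i by (auto simp: curve_point_def intro!: derivative_eq_intros)
    qed
    then have "((\<lambda>s. poly_eval f (curve_point n e s)) has_field_derivative
        (\<Sum>i<n. poly_eval (partial_deriv i f) (curve_point n e t) * ?v i)) (at t)"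
      by (intro poly_eval_has_field_derivative[OF _ fR]) auto
    moreover have "(\<lambda>s. poly_eval f (curve_point n e s)) = (\<lambda>_. 0)"
      using f by (auto simp: vanishing_ideal_def)
    ultimately have "(\<Sum>i<n. poly_eval (partial_deriv i f) (curve_point n e t) * ?v i) = 0"
      using DERIV_unique[OF _ DERIV_const] by metis
    then have "t ^ (e m - 1) *
        (\<Sum>i<n. poly_eval (partial_deriv i f) (curve_point n e t) * direction n e m t i) = 0"
      by (simp add: sum_distrib_left mult_ac)
    then show "(\<Sum>i<n. poly_eval (partial_deriv i f) (curve_point n e t) * direction n e m t i) = 0"
      using t by simp
  qed
  then show ?thesis
    by (simp add: tangent_space_def coord_space_def direction_def)
qed

text \<open>
  The differential of the binomial \<open>x\<^sub>i ^ e j - x\<^sub>j ^ e i\<close>, found by differentiating along the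
  line \<open>s \<mapsto> x + s w\<close>.
\<close>

lemma tangent_binomial_equation:
  assumes w: "w \<in> tangent_space n (monomial_curve n e) (curve_point n e t)" and ij: "i < n" "j < n"
  shows "of_nat (e j) * t ^ (e i * (e j - 1)) * w i = of_nat (e i) * t ^ (e j * (e i - 1)) * w j"
proof -
  let ?x = "curve_point n e t"
  let ?f = "Poly_Mapping.single (Poly_Mapping.single i (e j)) 1 -
    Poly_Mapping.single (Poly_Mapping.single j (e i)) 1 :: nat mpoly"
  have fR: "?f \<in> poly_ring {..<n}"
    using ij by (intro poly_ring_diff poly_ring_single) auto
  moreover have "poly_eval ?f (curve_point n e s) = 0" for s
    using ij by (simp add: poly_eval_diff curve_point_def flip: power_mult) (simp add: mult.commute)
  ultimately have "?f \<in> vanishing_ideal {..<n} (monomial_curve n e)"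
    by (simp add: vanishing_ideal_def)
  then have "(\<Sum>k<n. poly_eval (partial_deriv k ?f) ?x * w k) = 0"
    using w by (simp add: tangent_space_def)
  moreover have "((\<lambda>s. poly_eval ?f (\<lambda>k. ?x k + s * w k)) has_field_derivative
      (\<Sum>k<n. poly_eval (partial_deriv k ?f) (\<lambda>k. ?x k + 0 * w k) * w k)) (at 0)"
    by (rule poly_eval_has_field_derivative[OF _ fR]) (auto intro!: derivative_eq_intros)
  ultimately have "((\<lambda>s. (?x i + s * w i) ^ e j - (?x j + s * w j) ^ e i) has_field_derivative 0) (at 0)"
    by (simp add: poly_eval_diff)
  moreover have "((\<lambda>s. (?x i + s * w i) ^ e j - (?x j + s * w j) ^ e i) has_field_derivative
      of_nat (e j) * ?x i ^ (e j - 1) * w i - of_nat (e i) * ?x j ^ (e i - 1) * w j) (at 0)"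
    by (auto intro!: derivative_eq_intros)
  ultimately have "of_nat (e j) * ?x i ^ (e j - 1) * w i - of_nat (e i) * ?x j ^ (e i - 1) * w j = 0"
    by (rule DERIV_unique[symmetric])
  then show ?thesis
    using ij by (simp add: curve_point_def power_mult)
qed

lemma cvec_span_singleton: "cvec.span {v} = range (\<lambda>c i. c * v i)"
  by (rule cvec.span_singleton)

lemma cvec_dim_line: "v \<noteq> (\<lambda>_. 0) \<Longrightarrow> cvec.dim (cvec.span {v}) = 1"
  using cvec.dim_span_eq_card_independent[of "{v}"] by (simp add: zero_fun_def)

text \<open>
  For use at the origin of the curve, singular or not: if its tangent space is a line, then this
  line is the limit of the tangent lines.
\<close>

lemma cvec_line_unique:
  assumes "cvec.subspace T" "cvec.dim T = 1" "v \<in> T" "v \<noteq> (\<lambda>_. 0)"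
  shows "T = cvec.span {v}"
proof -
  obtain B where B: "B \<subseteq> T" "\<not> cvec.dependent B" "T \<subseteq> cvec.span B" "card B = cvec.dim T"
    using cvec.basis_exists[of T] by blast
  then obtain b where b: "B = {b}" using assms(2) by (metis card_1_singletonE)
  have "v \<in> range (\<lambda>c i. c * b i)"
    using B(3) assms(3) unfolding b cvec_span_singleton by (rule subsetD)
  then obtain c where c: "v = (\<lambda>i. c * b i)" by (rule rangeE)
  then have "c \<noteq> 0" using assms(4) by auto
  then have "b = (\<lambda>i. inverse c * v i)" by (auto simp: c)
  then have "b \<in> cvec.span {v}" unfolding cvec_span_singleton by blast
  then have "cvec.span {b} \<subseteq> cvec.span {v}"
    by (intro cvec.span_minimal cvec.subspace_span) simp
  then have "T \<subseteq> cvec.span {v}"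
    using B(3) b by simp
  moreover have "cvec.span {v} \<subseteq> T"
    using assms(1,3) by (simp add: cvec.span_minimal)
  ultimately show ?thesis by blast
qed

lemma cvec_subspace_tangent_space: "cvec.subspace (tangent_space n X x)"
  unfolding cvec.subspace_def
  by (auto simp: tangent_space_def coord_space_def distrib_left sum.distrib mult.left_commute
      simp flip: sum_distrib_left)

text \<open>
  Where \<open>t ^ (e i * (e m - 1))\<close> does not vanish, the binomials \<open>x\<^sub>i ^ e m - x\<^sub>m ^ e i\<close> force a tangent
  vector to be proportional to the direction.
\<close>

lemma tangent_space_monomial_curve:
  assumes e: "weights n e" and m: "minimal_weight n e m" and t: "t \<noteq> 0 \<or> e m = 1"
  shows "tangent_space n (monomial_curve n e) (curve_point n e t) = cvec.span {direction n e m t}"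
    (is "?T = _")
proof
  show "cvec.span {direction n e m t} \<subseteq> ?T"
    using direction_tangent[OF e m] cvec_subspace_tangent_space by (simp add: cvec.span_minimal)
  show "?T \<subseteq> cvec.span {direction n e m t}"
  proof
    fix w assume w: "w \<in> ?T"
    have em: "0 < e m" "m < n" using e m weights_pos by (auto simp: minimal_weight_def)
    have "w i = w m / of_nat (e m) * direction n e m t i" for i
    proof (cases "i < n")
      case True
      have le: "e m \<le> e i" using m True by (simp add: minimal_weight_def)
      have "e m * (e i - 1) = e i * (e m - 1) + (e i - e m)"
        using le em by (simp add: diff_mult_distrib2 mult.commute)
      then have "t ^ (e i * (e m - 1)) * (of_nat (e m) * w i) =
          t ^ (e i * (e m - 1)) * (of_nat (e i) * t ^ (e i - e m) * w m)"
        using tangent_binomial_equation[OF w True em(2)] by (simp add: power_add mult_ac)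
      moreover have "t ^ (e i * (e m - 1)) \<noteq> 0" using t by auto
      ultimately have "of_nat (e m) * w i = of_nat (e i) * t ^ (e i - e m) * w m"
        using mult_left_cancel by blast
      then show ?thesis using em True by (simp add: direction_def field_simps)
    next
      case False
      then show ?thesis using w by (simp add: direction_def tangent_space_def coord_space_def)
    qed
    then show "w \<in> cvec.span {direction n e m t}"
      unfolding cvec_span_singleton by blast
  qed
qed

lemma nonsingular_monomial_curve:
  assumes e: "weights n e" and m: "minimal_weight n e m" and "e m = 1"
  shows "nonsingular n (monomial_curve n e)"
proof -
  have "cvec.dim (tangent_space n (monomial_curve n e) (curve_point n e t)) = 1" for t
    using tangent_space_monomial_curve[OF e m] assms(3) cvec_dim_line direction_nonzero(1)[OF e m] by metis
  then have "singular_locus n 1 (monomial_curve n e) = {}"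
    by (auto simp: singular_locus_def)
  then show ?thesis
    unfolding nonsingular_def using equidimensional_monomial_curve[OF e] by blast
qed

section \<open>Morphisms into and out of the Grassmann bundle\<close>

lemma frame_preimage_subset: "frame_preimage d n Z \<subseteq> coord_space (frame_index d n)"
  by (auto simp: frame_preimage_def)

lemma frame_preimage_mono: "Z \<subseteq> Z' \<Longrightarrow> frame_preimage d n Z \<subseteq> frame_preimage d n Z'"
  by (auto simp: frame_preimage_def)

text \<open>
  Open sets and regular functions of the bundle are defined by pullback to the space of frames, so
  a map out of the bundle is a morphism as soon as its composition with the quotient map is.
\<close>

lemma morphism_from_grassmann_bundle:
  assumes E: "E \<subseteq> coord_space J" and maps: "\<phi> ` Z \<subseteq> E"
    and rat: "\<And>j. j \<in> J \<Longrightarrow>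
      rational_on (frame_index d n) (frame_preimage d n Z) (\<lambda>y. \<phi> (frame_quotient d y) j)"
  shows "morphism (subspace_of_grassmann_bundle d n Z) (subspace_of_affine J E) \<phi>"
proof -
  let ?F = "frame_preimage d n"
  let ?\<Phi> = "\<phi> \<circ> frame_quotient d"
  have mor: "morphism (subspace_of_affine (frame_index d n) (?F Z)) (subspace_of_affine J E) ?\<Phi>"
    by (rule morphism_rational[OF frame_preimage_subset E])
      (use maps rat in \<open>auto simp: frame_preimage_def\<close>)
  have pre: "?F (\<phi> -` V \<inter> Z) = ?\<Phi> -` V \<inter> ?F Z" for V
    by (auto simp: frame_preimage_def)
  have "points (subspace_of_affine (frame_index d n) (?F Z)) = ?F Z"
    by (simp add: subspace_of_affine_def)
  then show ?thesis
    using mor maps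
    unfolding morphism_def subspace_of_grassmann_bundle_def
    by (simp add: pre comp_assoc Let_def) (simp add: subspace_of_affine_def)
qed

text \<open>
  Since the structure of the bundle is pulled back to frames, preimages and pullbacks along a map
  that lifts to frames are preimages and pullbacks along the lift.
\<close>

lemma morphism_to_grassmann_bundle:
  assumes D: "D \<subseteq> coord_space I" and maps: "\<sigma> ` D \<subseteq> frame_preimage d n Z"
    and rat: "\<And>k. k \<in> frame_index d n \<Longrightarrow> rational_on I D (\<lambda>x. \<sigma> x k)"
  shows "morphism (subspace_of_affine I D) (subspace_of_grassmann_bundle d n Z) (frame_quotient d \<circ> \<sigma>)"
proof -
  let ?F = "frame_preimage d n"
  have mor: "morphism (subspace_of_affine I D) (subspace_of_affine (frame_index d n) (?F Z)) \<sigma>"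
    by (rule morphism_rational[OF D frame_preimage_subset maps rat])
  have pre: "\<sigma> -` ?F V \<inter> D = (frame_quotient d \<circ> \<sigma>) -` V \<inter> D" if "V \<subseteq> Z" for V
    using maps that by (auto simp: frame_preimage_def)
  have q: "frame_quotient d (\<sigma> x) \<in> Z" if "x \<in> D" for x
    using maps that by (auto simp: frame_preimage_def)
  have pt: "points (subspace_of_affine I D) = D"
    by (simp add: subspace_of_affine_def)
  have "(frame_quotient d \<circ> \<sigma>) -` V \<inter> D \<in> opens (subspace_of_affine I D) \<and>
      (\<forall>f. f \<circ> frame_quotient d \<in> regular (subspace_of_affine (frame_index d n) (?F Z)) (?F V) \<longrightarrow>
        f \<circ> (frame_quotient d \<circ> \<sigma>) \<in>
          regular (subspace_of_affine I D) ((frame_quotient d \<circ> \<sigma>) -` V \<inter> D))"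
    if "V \<subseteq> Z" "?F V \<in> opens (subspace_of_affine (frame_index d n) (?F Z))" for V
  proof -
    have "\<sigma> -` ?F V \<inter> D \<in> opens (subspace_of_affine I D) \<and>
        (\<forall>g\<in>regular (subspace_of_affine (frame_index d n) (?F Z)) (?F V).
          g \<circ> \<sigma> \<in> regular (subspace_of_affine I D) (\<sigma> -` ?F V \<inter> D))"
      using mor that(2) unfolding morphism_def pt by blast
    then show ?thesis
      unfolding pre[OF that(1)] comp_assoc[symmetric] by blast
  qed
  then show ?thesis
    using q unfolding morphism_def pt subspace_of_grassmann_bundle_def
    by (auto simp: Let_def)
qed

section \<open>Closure of the graph of the Gauss map\<close>

definition frame_of :: "(nat \<Rightarrow> complex) \<Rightarrow> (nat \<Rightarrow> complex) \<Rightarrow> framed_point" where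
  "frame_of x v = (\<lambda>k. case k of Inl i \<Rightarrow> x i | Inr (j, i) \<Rightarrow> if j = 0 then v i else 0)"

lemma frame_of_simps [simp]: "frame_of x v (Inl i) = x i" "frame_of x v (Inr (0, i)) = v i"
  by (simp_all add: frame_of_def)

lemma frame_of_coord_space:
  "x \<in> coord_space {..<n} \<Longrightarrow> v \<in> coord_space {..<n} \<Longrightarrow> frame_of x v \<in> coord_space (frame_index 1 n)"
  by (auto simp: frame_of_def coord_space_def frame_index_def Plus_def split: sum.splits)

lemma frame_span_1: "frame_span 1 y = cvec.span {\<lambda>i. y (Inr (0, i))}"
  by (simp add: frame_span_def lessThan_Suc)

lemma frame_quotient_frame_of: "frame_quotient 1 (frame_of x v) = (x, cvec.span {v})"
  unfolding frame_quotient_def frame_span_1 by (simp add: comp_def)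

lemma cvec_dim_line_iff: "cvec.dim (cvec.span {v}) = 1 \<longleftrightarrow> v \<noteq> (\<lambda>_. 0)"
proof
  show "v \<noteq> (\<lambda>_. 0)" if "cvec.dim (cvec.span {v}) = 1"
  proof
    assume "v = (\<lambda>_. 0)"
    then have "cvec.dim (cvec.span {v}) \<le> card ({} :: (nat \<Rightarrow> complex) set)"
      by (intro cvec.dim_le_card) (auto simp: cvec_span_singleton zero_fun_def)
    then show False using that by simp
  qed
qed (rule cvec_dim_line)

lemma frame_preimage_1_iff:
  "y \<in> frame_preimage 1 n Z \<longleftrightarrow> y \<in> coord_space (frame_index 1 n) \<and>
     (\<lambda>i. y (Inr (0, i))) \<noteq> (\<lambda>_. 0) \<and> (y \<circ> Inl, cvec.span {\<lambda>i. y (Inr (0, i))}) \<in> Z"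
  unfolding frame_preimage_def frame_quotient_def frame_span_1
  by (simp only: cvec_dim_line_iff mem_Collect_eq)

lemma cvec_line_eqE:
  assumes "cvec.span {v} = cvec.span {w}" "v \<noteq> (\<lambda>_. 0)"
  obtains c where "c \<noteq> 0" "v = (\<lambda>i. c * w i)"
proof -
  have "v \<in> range (\<lambda>c i. c * w i)"
    using cvec.span_base[of v "{v}"] assms(1) by (simp add: cvec_span_singleton)
  then obtain c where c: "v = (\<lambda>i. c * w i)" by (rule rangeE)
  then have "c \<noteq> 0" using assms(2) by auto
  then show ?thesis using that c by blast
qed

lemma cvec_line_scale:
  assumes "c \<noteq> 0"
  shows "cvec.span {\<lambda>i. c * w i} = cvec.span {w}"
proof -
  have "(\<lambda>i. c * w i) \<in> cvec.span {w}" unfolding cvec_span_singleton by blast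
  moreover have "w = (\<lambda>i. inverse c * (c * w i))" using assms by auto
  then have "w \<in> cvec.span {\<lambda>i. c * w i}" unfolding cvec_span_singleton by (rule range_eqI)
  ultimately show ?thesis
    by (intro equalityI cvec.span_minimal cvec.subspace_span) auto
qed

text \<open>
  The point of the Nash modification over the parameter \<open>t\<close>.  At \<open>t = 0\<close> it is the limit of the
  pairs of a point and its tangent line.
\<close>

definition nash_point :: "nat \<Rightarrow> (nat \<Rightarrow> nat) \<Rightarrow> nat \<Rightarrow> complex \<Rightarrow> (nat \<Rightarrow> complex) \<times> (nat \<Rightarrow> complex) set" where
  "nash_point n e m t = (curve_point n e t, cvec.span {direction n e m t})"

definition nash_frame :: "nat \<Rightarrow> (nat \<Rightarrow> nat) \<Rightarrow> nat \<Rightarrow> complex \<Rightarrow> framed_point" where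
  "nash_frame n e m t = frame_of (curve_point n e t) (direction n e m t)"

lemma direction_coord_space: "direction n e m t \<in> coord_space {..<n}"
  by (simp add: direction_def coord_space_def)

lemma nash_frame_mem_frame_preimage:
  assumes "weights n e" "minimal_weight n e m"
  shows "nash_frame n e m t \<in> frame_preimage 1 n Z \<longleftrightarrow> nash_point n e m t \<in> Z"
  unfolding frame_preimage_1_iff
  using direction_nonzero(1)[OF assms]
    frame_of_coord_space[OF curve_point_coord_space direction_coord_space]
  by (simp add: nash_frame_def nash_point_def comp_def)

lemma nash_point_eq: "nash_point n e m = frame_quotient 1 \<circ> nash_frame n e m"
  by (intro ext) (simp only: comp_apply nash_point_def nash_frame_def frame_quotient_frame_of)

lemma nash_point_inj: "weights n e \<Longrightarrow> inj (nash_point n e m)"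
  using curve_point_inj[of n e] by (auto simp: inj_def nash_point_def)

lemma mem_frame_preimage_nash:
  assumes e: "weights n e" and m: "minimal_weight n e m"
  shows "y \<in> frame_preimage 1 n (range (nash_point n e m)) \<longleftrightarrow>
    y \<in> coord_space (frame_index 1 n) \<and> (\<exists>t s. s \<noteq> 0 \<and> y \<circ> Inl = curve_point n e t \<and>
      (\<lambda>i. y (Inr (0, i))) = (\<lambda>i. s * direction n e m t i))"
    (is "?l \<longleftrightarrow> ?r")
proof
  assume ?l
  then have y: "y \<in> coord_space (frame_index 1 n)" "(\<lambda>i. y (Inr (0, i))) \<noteq> (\<lambda>_. 0)"
    and "(y \<circ> Inl, cvec.span {\<lambda>i. y (Inr (0, i))}) \<in> range (nash_point n e m)"
    unfolding frame_preimage_1_iff by blast+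
  then obtain t where t: "y \<circ> Inl = curve_point n e t"
    "cvec.span {\<lambda>i. y (Inr (0, i))} = cvec.span {direction n e m t}"
    by (auto simp: nash_point_def)
  obtain s where "s \<noteq> 0" "(\<lambda>i. y (Inr (0, i))) = (\<lambda>i. s * direction n e m t i)"
    using cvec_line_eqE[OF t(2) y(2)] .
  then show ?r using y(1) t(1) by blast
next
  assume ?r
  then obtain t s where y: "y \<in> coord_space (frame_index 1 n)" and s: "s \<noteq> 0"
    and t: "y \<circ> Inl = curve_point n e t" "(\<lambda>i. y (Inr (0, i))) = (\<lambda>i. s * direction n e m t i)"
    by blast
  have "(\<lambda>i. s * direction n e m t i) \<noteq> (\<lambda>_. 0)"
  proof
    assume "(\<lambda>i. s * direction n e m t i) = (\<lambda>_. 0)"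
    then have "s * direction n e m t m = 0" by metis
    then show False using s direction_nonzero(2,3)[OF e m] by simp
  qed
  moreover have "(curve_point n e t, cvec.span {\<lambda>i. s * direction n e m t i}) = nash_point n e m t"
    by (simp add: nash_point_def cvec_line_scale[OF s])
  ultimately show ?l
    unfolding frame_preimage_1_iff t using y by simp
qed

lemma nash_point_mem_bundle:
  assumes "weights n e" "minimal_weight n e m"
  shows "nash_point n e m t \<in> monomial_curve n e \<times> grassmannian 1 n"
proof -
  have "cvec.span {direction n e m t} \<subseteq> coord_space {..<n}"
    by (auto simp: cvec_span_singleton direction_def coord_space_def)
  then show ?thesis
    using cvec_dim_line[OF direction_nonzero(1)[OF assms]]
    by (simp add: nash_point_def grassmannian_def)
qed

text \<open>
  Polynomials on the space of frames that cut out the pairs \<open>nash_point n e m t\<close>.  Those of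
  the first family say that \<open>(e\<^sub>i x\<^sub>i)\<close> and the frame vector \<open>v\<close> are proportional; they
  suffice where \<open>x \<noteq> 0\<close> but are vacuous where \<open>x = 0\<close>.  The other two come from
  \<open>v\<^sub>i / v\<^sub>m = (e\<^sub>i / e\<^sub>m) t ^ (e i - e m)\<close> with \<open>t\<close> eliminated through
  \<open>x\<^sub>m = t ^ e m\<close>; over the origin they leave only the limit line.  All are homogeneous in \<open>v\<close>.
\<close>

definition nash_equations :: "nat \<Rightarrow> (nat \<Rightarrow> nat) \<Rightarrow> nat \<Rightarrow> (framed_point \<Rightarrow> complex) set" where
  "nash_equations n e m =
     (\<lambda>i y. of_nat (e m) * y (Inl m) * y (Inr (0, i)) - of_nat (e i) * y (Inl i) * y (Inr (0, m))) ` {..<n} \<union>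
     (\<lambda>i y. (of_nat (e m) * y (Inr (0, i))) ^ e m -
        (of_nat (e i) * y (Inr (0, m))) ^ e m * y (Inl m) ^ (e i - e m)) ` {i. i < n \<and> e i \<noteq> e m} \<union>
     (\<lambda>i y. y (Inr (0, i)) - y (Inr (0, m))) ` {i. i < n \<and> e i = e m}"

lemma nash_equations_zero_iff:
  "(\<forall>f\<in>nash_equations n e m. f y = 0) \<longleftrightarrow>
    (\<forall>i\<in>{..<n}. of_nat (e m) * y (Inl m) * y (Inr (0, i)) = of_nat (e i) * y (Inl i) * y (Inr (0, m))) \<and>
    (\<forall>i\<in>{i. i < n \<and> e i \<noteq> e m}. (of_nat (e m) * y (Inr (0, i))) ^ e m =
       (of_nat (e i) * y (Inr (0, m))) ^ e m * y (Inl m) ^ (e i - e m)) \<and>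
    (\<forall>i\<in>{i. i < n \<and> e i = e m}. y (Inr (0, i)) = y (Inr (0, m)))"
  unfolding nash_equations_def ball_Un ball_simps(9) right_minus_eq conj_assoc ..

lemma frame_preimage_nash_eq:
  assumes e: "weights n e" and m: "minimal_weight n e m"
  shows "frame_preimage 1 n (range (nash_point n e m)) =
    {y \<in> frame_preimage 1 n (monomial_curve n e \<times> grassmannian 1 n). \<forall>f\<in>nash_equations n e m. f y = 0}"
    (is "?W = {y\<in>?P. _}")
proof (intro equalityI subsetI CollectI conjI ballI)
  have mn: "m < n" and le: "\<And>i. i < n \<Longrightarrow> e m \<le> e i" and em: "0 < e m"
    using e m weights_pos by (auto simp: minimal_weight_def)
  fix y
  {
    assume y: "y \<in> ?W"
    then show "y \<in> ?P"
      by (rule subsetD[OF frame_preimage_mono, rotated]) (use nash_point_mem_bundle[OF e m] in blast)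
    obtain t s where "y \<circ> Inl = curve_point n e t" "(\<lambda>i. y (Inr (0, i))) = (\<lambda>i. s * direction n e m t i)"
      using y unfolding mem_frame_preimage_nash[OF e m] by blast
    then have x: "y (Inl i) = t ^ e i" and v: "y (Inr (0, i)) = s * of_nat (e i) * t ^ (e i - e m)"
      if "i < n" for i
      using that by (auto simp: curve_point_def direction_def fun_eq_iff comp_def)
    have split: "t ^ e i = t ^ e m * t ^ (e i - e m)" if "i < n" for i
      using le[OF that] by (simp flip: power_add)
    have "of_nat (e m) * y (Inl m) * y (Inr (0, i)) = of_nat (e i) * y (Inl i) * y (Inr (0, m))"
      if "i < n" for i
      using mn that by (simp add: x v split[OF that])
    moreover have "(t ^ e m) ^ (e i - e m) = (t ^ (e i - e m)) ^ e m" for i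
      by (simp add: mult.commute flip: power_mult)
    then have "(of_nat (e m) * y (Inr (0, i))) ^ e m =
        (of_nat (e i) * y (Inr (0, m))) ^ e m * y (Inl m) ^ (e i - e m)" if "i < n" for i
      using that mn by (simp add: x v power_mult_distrib)
    moreover have "y (Inr (0, i)) = y (Inr (0, m))" if "i < n" "e i = e m" for i
      using that mn by (simp add: v)
    ultimately have "\<forall>f\<in>nash_equations n e m. f y = 0"
      unfolding nash_equations_zero_iff by blast
    then show "f y = 0" if "f \<in> nash_equations n e m" for f
      using that by blast
  }
  assume "y \<in> {y\<in>?P. \<forall>f\<in>nash_equations n e m. f y = 0}"
  then have "y \<in> ?P \<and> (\<forall>f\<in>nash_equations n e m. f y = 0)" by (rule CollectD)
  note P = this[THEN conjunct1] and eqs = this[THEN conjunct2]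
  have y: "y \<in> coord_space (frame_index 1 n)" and v0: "(\<lambda>i. y (Inr (0, i))) \<noteq> (\<lambda>_. 0)"
    using P unfolding frame_preimage_1_iff by blast+
  obtain t where t: "y \<circ> Inl = curve_point n e t"
    using P unfolding frame_preimage_1_iff by blast
  then have x: "y (Inl i) = t ^ e i" if "i < n" for i
    using that by (auto simp: curve_point_def fun_eq_iff comp_def)
  let ?v = "\<lambda>i. y (Inr (0, i))"
  define s where "s = ?v m / of_nat (e m)"
  have "?v i = s * direction n e m t i" for i
  proof (cases "i < n")
    case False
    then have "Inr (0, i) \<notin> frame_index 1 n" by (auto simp: frame_index_def)
    then show ?thesis using y False by (simp add: coord_space_def direction_def)
  next
    case i: True
    note eqs = eqs[unfolded nash_equations_zero_iff]
    have eq1: "of_nat (e m) * t ^ e m * ?v i = of_nat (e i) * t ^ e i * ?v m"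
      using bspec[OF eqs[THEN conjunct1], of i] i mn by (simp add: x)
    have eq2: "(of_nat (e m) * ?v i) ^ e m = (of_nat (e i) * ?v m) ^ e m * (t ^ e m) ^ (e i - e m)"
      if "e i \<noteq> e m"
      using bspec[OF eqs[THEN conjunct2, THEN conjunct1], of i] i that unfolding x[OF mn] by blast
    have eq3: "?v i = ?v m" if "e i = e m"
      using bspec[OF eqs[THEN conjunct2, THEN conjunct2], of i] i that by blast
    have "of_nat (e m) * ?v i = of_nat (e i) * t ^ (e i - e m) * ?v m"
    proof (cases "t = 0")
      case True
      show ?thesis
      proof (cases "e i = e m")
        case False
        then have "0 < e i - e m" using le[OF i] by simp
        then show ?thesis using eq2[OF False] em True by (simp add: zero_power)
      qed (use eq3 in simp)
    next
      case False
      have "t ^ e i = t ^ e m * t ^ (e i - e m)"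
        using le[OF i] by (simp flip: power_add)
      then have "t ^ e m * (of_nat (e m) * ?v i) = t ^ e m * (of_nat (e i) * t ^ (e i - e m) * ?v m)"
        using eq1 by (simp add: mult_ac)
      then show ?thesis using False by simp
    qed
    then show ?thesis
      using em i by (simp add: s_def direction_def field_simps)
  qed
  note v = this
  have "s \<noteq> 0"
  proof
    assume "s = 0"
    then show False using v v0 by auto
  qed
  then show "y \<in> ?W"
    unfolding mem_frame_preimage_nash[OF e m] using y t v by blast
qed

lemma nash_equations_polynomial:
  assumes "m < n" "f \<in> nash_equations n e m"
  shows "polynomial_function (frame_index 1 n) f"
proof -
  have "polynomial_function (frame_index 1 n) (\<lambda>y. y (Inl i))"
    "polynomial_function (frame_index 1 n) (\<lambda>y. y (Inr (0, i)))" if "i < n" for i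
    using that by (auto intro!: polynomial_function_coord simp: frame_index_def)
  then show ?thesis
    using assms unfolding nash_equations_def
    by (auto intro!: polynomial_function_const polynomial_function_diff polynomial_function_mult
        polynomial_function_power)
qed

text \<open>
  The equations make the right-hand side closed, and it contains the graph.  Conversely an equation of
  a closed set containing the graph vanishes at all parameters \<open>t \<noteq> 0\<close>, hence also at \<open>0\<close>.
\<close>

lemma nash_closure_monomial_curve:
  assumes e: "weights n e" and m: "minimal_weight n e m"
  shows "nash_closure n 1 (monomial_curve n e) = range (nash_point n e m)"
proof
  let ?Y = "monomial_curve n e" and ?W = "range (nash_point n e m)"
  let ?P = "?Y \<times> grassmannian 1 n" and ?G = "gauss_graph n 1 ?Y"
  let ?F = "frame_preimage 1 n"
  let ?T = "\<lambda>t. tangent_space n ?Y (curve_point n e t)"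
  have open_iff: "U \<in> opens (subspace_of_grassmann_bundle 1 n ?P) \<longleftrightarrow>
      U \<subseteq> ?P \<and> ?F U \<in> zariski_opens (frame_index 1 n) (?F ?P)" for U
    by (simp add: subspace_of_grassmann_bundle_def subspace_of_affine_def Let_def)
  have line: "?T t = cvec.span {direction n e m t}" if "cvec.dim (?T t) = 1" for t
    using cvec_line_unique[OF cvec_subspace_tangent_space that direction_tangent[OF e m]
        direction_nonzero(1)[OF e m]] .
  then have G: "?G \<subseteq> ?W"
    by (auto simp: gauss_graph_def singular_locus_def nash_point_def)
  have WP: "?W \<subseteq> ?P" using nash_point_mem_bundle[OF e m] by blast
  have "?F (?P - ?W) = ?F ?P - ?F ?W"
    unfolding frame_preimage_def by blast
  also have "\<dots> = {y\<in>?F ?P. \<exists>f\<in>nash_equations n e m. f y \<noteq> 0}"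
    unfolding frame_preimage_nash_eq[OF e m] by blast
  also have "\<dots> \<in> zariski_opens (frame_index 1 n) (?F ?P)"
    using m by (intro mem_zariski_opensI[OF frame_preimage_subset _ refl] nash_equations_polynomial)
      (auto simp: minimal_weight_def)
  finally have "?P - ?W \<in> opens (subspace_of_grassmann_bundle 1 n ?P)"
    unfolding open_iff by blast
  then show "nash_closure n 1 ?Y \<subseteq> ?W"
    unfolding nash_closure_def Let_def using G WP by (intro Inter_lower CollectI conjI)
  show "?W \<subseteq> nash_closure n 1 ?Y"
    unfolding nash_closure_def Let_def
  proof (intro Inter_greatest subsetI)
    fix Z z
    assume Z: "Z \<in> {Z. Z \<subseteq> ?P \<and> ?G \<subseteq> Z \<and> ?P - Z \<in> opens (subspace_of_grassmann_bundle 1 n ?P)}"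
      and "z \<in> ?W"
    then obtain t where t: "z = nash_point n e m t" by blast
    have "?F (?P - Z) \<in> zariski_opens (frame_index 1 n) (?F ?P)"
      using Z unfolding open_iff by simp
    then obtain S where S: "S \<subseteq> poly_ring (frame_index 1 n)"
      "?F (?P - Z) = {y\<in>?F ?P. \<exists>p\<in>S. poly_eval p y \<noteq> 0}"
      by (rule zariski_opens_nonvanishing[OF _ frame_preimage_subset])
    have mem: "nash_point n e m t \<notin> Z \<longleftrightarrow> (\<exists>p\<in>S. poly_eval p (nash_frame n e m t) \<noteq> 0)" for t
    proof -
      have "nash_point n e m t \<notin> Z \<longleftrightarrow> nash_frame n e m t \<in> ?F (?P - Z)"
        unfolding nash_frame_mem_frame_preimage[OF e m] using nash_point_mem_bundle[OF e m, of t] by blast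
      moreover have "nash_frame n e m t \<in> ?F ?P"
        unfolding nash_frame_mem_frame_preimage[OF e m] by (rule nash_point_mem_bundle[OF e m])
      ultimately show ?thesis
        unfolding S(2) by simp
    qed
    show "z \<in> Z"
    proof (rule ccontr)
      assume "z \<notin> Z"
      then obtain p where p: "p \<in> S" "poly_eval p (nash_frame n e m t) \<noteq> 0"
        using mem t by blast
      have "poly_eval p (nash_frame n e m s) = 0" if s: "s \<noteq> 0" for s
      proof -
        have "?T s = cvec.span {direction n e m s}"
          using tangent_space_monomial_curve[OF e m] s by blast
        then have "nash_point n e m s \<in> ?G"
          using cvec_dim_line[OF direction_nonzero(1)[OF e m]]
          by (auto simp: gauss_graph_def singular_locus_def nash_point_def)
        then show ?thesis using mem p(1) Z by blast
      qed
      moreover have "parameter_polynomial (\<lambda>s. poly_eval p (nash_frame n e m s))"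
      proof (rule parameter_polynomial_poly_eval)
        show "p \<in> poly_ring (frame_index 1 n)" using p(1) S(1) by blast
        show "parameter_polynomial (\<lambda>s. nash_frame n e m s k)" if "k \<in> frame_index 1 n" for k
          using that parameter_polynomial_monomial[of 1]
          by (auto simp: frame_index_def nash_frame_def curve_point_def direction_def
              parameter_polynomial_monomial)
      qed
      ultimately show False
        using parameter_polynomial_eq_0 p(2) by blast
    qed
  qed
qed

section \<open>The Nash modification is again a monomial curve\<close>

text \<open>
  The difference \<open>e i - e m\<close> is the exponent of \<open>t\<close> in the slope \<open>v\<^sub>i / v\<^sub>m\<close> of the tangent line.  Where it
  is \<open>0\<close> the slope is constant, and the coordinate is reused for another copy of \<open>x\<^sub>m = t ^ e m\<close>, so that
  all weights stay positive.  In particular \<open>x\<^sub>m\<close> itself is kept.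
\<close>

definition nash_weights :: "(nat \<Rightarrow> nat) \<Rightarrow> nat \<Rightarrow> nat \<Rightarrow> nat" where
  "nash_weights e m = (\<lambda>i. if e i = e m then e m else e i - e m)"

lemma weights_nash_weights:
  assumes e: "weights n e" and m: "minimal_weight n e m"
  shows "weights n (nash_weights e m)"
proof -
  have mn: "m < n" and le: "\<And>i. i < n \<Longrightarrow> e m \<le> e i" and em: "0 < e m"
    using e m weights_pos by (auto simp: minimal_weight_def)
  define g where "g = Gcd (nash_weights e m ` {..<n})"
  have d: "g dvd nash_weights e m i" if "i < n" for i
    unfolding g_def using that by (intro Gcd_dvd imageI) simp
  have gm: "g dvd e m" using d[OF mn] by (simp add: nash_weights_def)
  have "g dvd e i" if "i < n" for i
  proof (cases "e i = e m")
    case False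
    then show ?thesis
      using d[OF that] gm le[OF that] by (auto simp: nash_weights_def intro: dvd_diffD)
  qed (use gm in simp)
  then have "g dvd Gcd (e ` {..<n})" by (intro Gcd_greatest) auto
  then have "g = 1" using e by (simp add: weights_def)
  moreover have "0 < nash_weights e m i" if "i < n" for i
    using le[OF that] em by (simp add: nash_weights_def)
  ultimately show ?thesis
    by (simp add: weights_def g_def)
qed

text \<open>
  Both curves are parametrised injectively by \<open>t\<close>, which determines the isomorphism.  From right to
  left it lifts to a polynomial map into frames, because \<open>t ^ e i = t ^ e m * t ^ (e i - e m)\<close>.  From
  left to right its coordinates are \<open>x\<^sub>m\<close> and, up to constants, the slopes \<open>v\<^sub>i / v\<^sub>m\<close> of the tangent
  line, which have no poles because \<open>v\<^sub>m\<close> never vanishes on the closure.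
\<close>

lemma nash_modification_monomial_curve:
  assumes e: "weights n e" and m: "minimal_weight n e m"
  shows "\<exists>\<nu>. nash_modification n (monomial_curve n e) n (monomial_curve n (nash_weights e m)) \<nu>"
proof -
  have mn: "m < n" and le: "\<And>i. i < n \<Longrightarrow> e m \<le> e i" and em: "0 < e m"
    using e m weights_pos by (auto simp: minimal_weight_def)
  define e' where "e' = nash_weights e m"
  have e': "weights n e'" unfolding e'_def by (rule weights_nash_weights[OF e m])
  let ?W = "range (nash_point n e m)" and ?Y' = "monomial_curve n e'"
  define \<tau> where "\<tau> = inv (curve_point n e')"
  have \<tau>: "\<tau> (curve_point n e' t) = t" for t
    unfolding \<tau>_def by (rule inv_f_f[OF curve_point_inj[OF e']])
  define \<phi> where "\<phi> = curve_point n e' \<circ> inv (nash_point n e m)"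
  have \<phi>: "\<phi> (nash_point n e m t) = curve_point n e' t" for t
    by (simp add: \<phi>_def inv_f_f[OF nash_point_inj[OF e]])
  let ?\<sigma> = "nash_frame n e m \<circ> \<tau>"
  have Y'_coord: "?Y' \<subseteq> coord_space {..<n}" using curve_point_coord_space by blast
  have \<phi>_morphism: "morphism (subspace_of_grassmann_bundle 1 n ?W) (subspace_of_affine {..<n} ?Y') \<phi>"
  proof (rule morphism_from_grassmann_bundle[OF Y'_coord])
    show "\<phi> ` ?W \<subseteq> ?Y'" by (auto simp: \<phi>)
    fix j assume "j \<in> {..<n}"
    then have j: "j < n" by simp
    have key: "y (Inr (0, m)) \<noteq> 0 \<and> \<phi> (frame_quotient 1 y) j =
        (if e j = e m then y (Inl m) else of_nat (e m) * y (Inr (0, j)) / (of_nat (e j) * y (Inr (0, m))))"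
      if yW: "y \<in> frame_preimage 1 n ?W" for y
    proof -
      obtain t s where s: "s \<noteq> 0" and y: "y \<circ> Inl = curve_point n e t"
        "(\<lambda>i. y (Inr (0, i))) = (\<lambda>i. s * direction n e m t i)"
        using yW unfolding mem_frame_preimage_nash[OF e m] by blast
      have "frame_quotient 1 y = nash_point n e m t"
        unfolding frame_quotient_def frame_span_1 y nash_point_def cvec_line_scale[OF s] ..
      then have "\<phi> (frame_quotient 1 y) j = t ^ e' j"
        using j by (simp add: \<phi>) (simp add: curve_point_def)
      moreover have "y (Inl m) = t ^ e m"
        using fun_cong[OF y(1), of m] mn by (simp add: curve_point_def)
      moreover have "y (Inr (0, i)) = s * (of_nat (e i) * t ^ (e i - e m))" if "i < n" for i
        using fun_cong[OF y(2), of i] that by (simp add: direction_def)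
      ultimately show ?thesis
        using s em mn j weights_pos[OF e j] by (simp add: e'_def nash_weights_def)
    qed
    have "Inl m \<in> frame_index 1 n" "Inr (0, m) \<in> frame_index 1 n" "Inr (0, j) \<in> frame_index 1 n"
      using mn j by (auto simp: frame_index_def)
    note poly = this[THEN polynomial_function_coord]
    show "rational_on (frame_index 1 n) (frame_preimage 1 n ?W) (\<lambda>y. \<phi> (frame_quotient 1 y) j)"
    proof (cases "e j = e m")
      case True
      then show ?thesis
        using key by (intro rational_on_polynomial[OF poly(1)]) simp
    next
      case False
      show ?thesis
      proof (rule rational_onI)
        show "polynomial_function (frame_index 1 n) (\<lambda>y. of_nat (e m) * y (Inr (0, j)))"
          "polynomial_function (frame_index 1 n) (\<lambda>y. of_nat (e j) * y (Inr (0, m)))"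
          by (rule polynomial_function_mult[OF polynomial_function_const poly(3)],
              rule polynomial_function_mult[OF polynomial_function_const poly(2)])
      qed (use key False weights_pos[OF e j] in auto)
    qed
  qed
  have \<psi>_morphism: "morphism (subspace_of_affine {..<n} ?Y') (subspace_of_grassmann_bundle 1 n ?W)
      (frame_quotient 1 \<circ> ?\<sigma>)"
  proof (rule morphism_to_grassmann_bundle[OF Y'_coord])
    show "?\<sigma> ` ?Y' \<subseteq> frame_preimage 1 n ?W"
      using nash_frame_mem_frame_preimage[OF e m] by auto
    fix k assume k: "k \<in> frame_index 1 n"
    \<comment> \<open>The coordinates \<open>z\<close> of the point with parameter \<open>t\<close> give \<open>t ^ (e i - e m)\<close> by \<open>ratio\<close>
      and \<open>t ^ e m\<close> by \<open>zm\<close>.\<close>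
    have ratio: "polynomial_function {..<n} (\<lambda>z. if e i = e m then 1 else z i)"
      "\<And>t. (if e i = e m then 1 else curve_point n e' t i) = t ^ (e i - e m)" if "i < n" for i
      by (cases "e i = e m"; use that in \<open>auto intro: polynomial_function_const polynomial_function_coord
          simp: curve_point_def e'_def nash_weights_def\<close>)+
    have zm: "curve_point n e' t m = t ^ e m" for t
      using mn by (simp add: curve_point_def e'_def nash_weights_def)
    consider i where "i < n" "k = Inl i" | i where "i < n" "k = Inr (0, i)"
      using k by (auto simp: frame_index_def)
    then show "rational_on {..<n} ?Y' (\<lambda>z. ?\<sigma> z k)"
    proof cases
      case 1
      have "t ^ e i = t ^ e m * t ^ (e i - e m)" for t :: complex
        using le[OF 1(1)] by (simp flip: power_add)
      then show ?thesis
        using 1 mn ratio[OF 1(1)]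
        by (intro rational_on_polynomial[of _ "\<lambda>z. z m * (if e i = e m then 1 else z i)"])
          (auto intro!: polynomial_function_mult polynomial_function_coord
            simp: \<tau> zm nash_frame_def curve_point_def[of n e])
    next
      case 2
      then show ?thesis
        using ratio[OF 2(1)]
        by (intro rational_on_polynomial[of _ "\<lambda>z. of_nat (e i) * (if e i = e m then 1 else z i)"])
          (auto intro!: polynomial_function_mult polynomial_function_const
            simp: \<tau> nash_frame_def direction_def)
    qed
  qed
  have \<psi>: "(frame_quotient 1 \<circ> ?\<sigma>) (curve_point n e' t) = nash_point n e m t" for t
    by (simp add: nash_point_eq \<tau>)
  have "isomorphism (subspace_of_grassmann_bundle 1 n ?W) (subspace_of_affine {..<n} ?Y') \<phi>"
    unfolding isomorphism_def
  proof (intro conjI exI)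
    show "\<forall>x\<in>points (subspace_of_grassmann_bundle 1 n ?W). (frame_quotient 1 \<circ> ?\<sigma>) (\<phi> x) = x"
      using \<psi> by (auto simp: subspace_of_grassmann_bundle_def Let_def \<phi>)
    show "\<forall>y\<in>points (subspace_of_affine {..<n} ?Y'). \<phi> ((frame_quotient 1 \<circ> ?\<sigma>) y) = y"
      using \<psi> \<phi> by (auto simp: subspace_of_affine_def)
  qed (fact \<phi>_morphism \<psi>_morphism)+
  moreover have "\<forall>z\<in>?W. (curve_point n e \<circ> \<tau>) (\<phi> z) = fst z"
    by (auto simp: \<phi> \<tau>) (simp add: nash_point_def)
  ultimately have "nash_modification n (monomial_curve n e) n ?Y' (curve_point n e \<circ> \<tau>)"
    unfolding nash_modification_def
    using algebraic_set_monomial_curve[OF e'] equidimensional_monomial_curve[OF e]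
      nash_closure_monomial_curve[OF e m] by (metis (no_types, lifting))
  then show ?thesis unfolding e'_def by blast
qed

section \<open>Resolution\<close>

lemma minimal_weight_exists:
  assumes "0 < n"
  obtains m where "minimal_weight n e m"
proof -
  obtain m where "m \<in> {..<n}" "\<And>i. i \<in> {..<n} \<Longrightarrow> e m \<le> e i"
    using ex_min_if_finite[of "e ` {..<n}"] assms
    by (metis arg_min_if_finite(1) arg_min_least finite_lessThan lessThan_empty_iff less_numeral_extra(3))
  then show ?thesis using that by (auto simp: minimal_weight_def)
qed

text \<open>
  If all weights were equal then they would be equal to their greatest common divisor \<open>1\<close>; so as
  long as the smallest weight is not \<open>1\<close>, subtracting it makes some weight smaller.
\<close>

lemma sum_nash_weights_less:
  assumes e: "weights n e" and m: "minimal_weight n e m" and "e m \<noteq> 1"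
  shows "(\<Sum>i<n. nash_weights e m i) < (\<Sum>i<n. e i)"
proof -
  have mn: "m < n" and le: "\<And>i. i < n \<Longrightarrow> e m \<le> e i" and em: "0 < e m"
    using e m weights_pos by (auto simp: minimal_weight_def)
  have "\<exists>i<n. e i \<noteq> e m"
  proof (rule ccontr)
    assume "\<not> (\<exists>i<n. e i \<noteq> e m)"
    then have "e ` {..<n} \<subseteq> {e m}" by blast
    moreover have "{e m} \<subseteq> e ` {..<n}" using mn by blast
    ultimately have "e ` {..<n} = {e m}" by blast
    then show False using e assms(3) by (simp add: weights_def)
  qed
  then obtain i where i: "i < n" "e i \<noteq> e m" by blast
  show ?thesis
  proof (rule sum_strict_mono_ex1)
    show "\<forall>i\<in>{..<n}. nash_weights e m i \<le> e i"
      by (auto simp: nash_weights_def)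
    show "\<exists>i\<in>{..<n}. nash_weights e m i < e i"
      using i le[OF i(1)] em by (auto simp: nash_weights_def intro!: bexI[of _ i])
  qed simp
qed

text \<open>
  Stated for a curve that has already been reached after \<open>k\<close> steps, since the definition of iterated
  modifications adds each further step at the end.
\<close>

lemma monomial_curve_resolution:
  assumes "weights n e" "iterated_nash_modification l X k n (monomial_curve n e) \<mu>"
  shows "\<exists>k m Z \<nu>. iterated_nash_modification l X k m Z \<nu> \<and> nonsingular m Z"
  using assms
proof (induction "\<Sum>i<n. e i" arbitrary: e k \<mu> rule: less_induct)
  case less
  obtain m where m: "minimal_weight n e m"
    using minimal_weight_exists weights_nonempty[OF less.prems(1)] .
  show ?case
  proof (cases "e m = 1")
    case True
    then show ?thesis
      using nonsingular_monomial_curve[OF less.prems(1) m] less.prems(2) by blast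
  next
    case False
    obtain \<nu> where "nash_modification n (monomial_curve n e) n (monomial_curve n (nash_weights e m)) \<nu>"
      using nash_modification_monomial_curve[OF less.prems(1) m] by blast
    then have "iterated_nash_modification l X (Suc k) n (monomial_curve n (nash_weights e m)) (\<mu> \<circ> \<nu>)"
      by (rule iterated_nash_modification.step[OF less.prems(2)])
    then show ?thesis
      by (rule less.hyps[OF sum_nash_weights_less[OF less.prems(1) m False]
            weights_nash_weights[OF less.prems(1) m]])
  qed
qed

theorem proposition3p4:
  fixes n :: nat and a :: "nat \<Rightarrow> int"
  assumes "1 \<le> n"
    and "0 < a 0"
    and "strict_mono_on {..<n} a"
    and "Gcd (a ` {..<n}) = 1"
  shows "\<exists>k m Z \<nu>. iterated_nash_modification n (toric_curve n a) k m Z \<nu> \<and> nonsingular m Z"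
proof -
  define e where "e = (\<lambda>i. nat (a i))"
  have pos: "0 < a i" if "i < n" for i
    using assms(2) strict_mono_onD[OF assms(3), of 0 i] that by (cases "i = 0") auto
  then have a: "a i = int (e i)" if "i < n" for i
    using that by (simp add: e_def order_less_imp_le)
  then have "a ` {..<n} = int ` e ` {..<n}" by (auto simp: image_image)
  then have "int (Gcd (e ` {..<n})) = 1"
    using assms(4) by simp
  then have e: "weights n e"
    using pos by (simp add: weights_def e_def)
  then have "iterated_nash_modification n (toric_curve n a) 0 n (monomial_curve n e) id"
    using iterated_nash_modification.zero[of n "toric_curve n a"]
    by (simp add: toric_curve_eq_monomial_curve[OF e a])
  then show ?thesis
    by (rule monomial_curve_resolution[OF e])
qed

end
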